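(* Let $R$ be a local Artinian Gorenstein ring. If $M$ is a nonzero syzygy of a proper trace module over $R$ (that is, $M\neq 0$ and $M\cong\Omega^n N$ for some $n\in\mathbb{Z}$ and some $R$-module $N$ that is a proper trace module in some $R$-module $X$), then $\operatorname{Ext}^1_R(M,M)\neq 0$. In particular, if $M=\Omega^n I$ for some nonzero proper ideal $I\subsetneq R$ and some $n\in\mathbb{Z}$, then $M$ is not rigid.
   Context: $R$ is a commutative Noetherian ring. A commutative Noetherian ring is Artinian Gorenstein if and only if it is self-injective (injective as a module over itself). For $R$-modules $A$ and $X$, the trace module of $A$ in $X$ is $\tau_A(X):=\sum_{\alpha\in\operatorname{Hom}_R(A,X)}\alpha(A)\subseteq X$. An $R$-module $N$ is a trace module in $X$ if $N=\tau_A(X)\subseteq X$ for some $R$-module $A$. It is a proper trace module in $X$ if moreover $N\subsetneq X$. An $R$-module $M$ is rigid if $\operatorname{Ext}^1_R(M,M)=0$. Syzygies may be positive or negative. $\Omega^0N=N$. For $n>0$, $\Omega^nN$ is the $n$-th syzygy in the minimal free resolution of $N$: $\Omega N$ is the kernel of a projective cover of $N$, and this is iterated. For $n<0$, $\Omega^{n}N$ is the $|n|$-th cosyzygy in the minimal injective resolution of $N$: $\Omega^{-1}N$ is the cokernel of an injective hull of $N$ (which is free, since $R$ is self-injective), and this is iterated. *)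

theory Defs
  imports "HOL-Algebra.Algebra"
begin

text \<open>
  Modules are the carrier-based ones of HOL-Algebra; the fields \<open>mult\<close> and \<open>one\<close> that the record
  \<open>module\<close> inherits from \<open>ring\<close> carry no meaning. A submodule \<open>H\<close> of \<open>M\<close> is regarded as the module
  \<open>M\<lparr>carrier := H\<rparr>\<close>. Modules are not assumed to be finitely generated.
\<close>

section \<open>Homomorphisms and exact sequences\<close>

text \<open>Extensional maps, so that \<open>mod_Hom R M N\<close> is a group under pointwise addition.\<close>

definition mod_Hom ::
  "('r, 's) ring_scheme \<Rightarrow> ('r, 'm) module \<Rightarrow> ('r, 'n) module \<Rightarrow> ('m \<Rightarrow> 'n) set" where
  "mod_Hom R M N = {f \<in> carrier M \<rightarrow>\<^sub>E carrier N.
     (\<forall>x\<in>carrier M. \<forall>y\<in>carrier M. f (x \<oplus>\<^bsub>M\<^esub> y) = f x \<oplus>\<^bsub>N\<^esub> f y) \<and>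
     (\<forall>a\<in>carrier R. \<forall>x\<in>carrier M. f (a \<odot>\<^bsub>M\<^esub> x) = a \<odot>\<^bsub>N\<^esub> f x)}"

definition mod_iso ::
  "('r, 's) ring_scheme \<Rightarrow> ('r, 'm) module \<Rightarrow> ('r, 'n) module \<Rightarrow> bool" where
  "mod_iso R M N \<longleftrightarrow> module R M \<and> module R N \<and>
     (\<exists>f\<in>mod_Hom R M N. bij_betw f (carrier M) (carrier N))"

definition zero_mod :: "('r, 'm) module \<Rightarrow> bool" where
  "zero_mod M \<longleftrightarrow> carrier M = {\<zero>\<^bsub>M\<^esub>}"

definition short_exact ::
  "('r, 's) ring_scheme \<Rightarrow> ('r, 'a) module \<Rightarrow> ('a \<Rightarrow> 'b) \<Rightarrow> ('r, 'b) module \<Rightarrow> ('b \<Rightarrow> 'c)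
     \<Rightarrow> ('r, 'c) module \<Rightarrow> bool" where
  "short_exact R A i B p C \<longleftrightarrow> module R A \<and> module R B \<and> module R C \<and>
     i \<in> mod_Hom R A B \<and> p \<in> mod_Hom R B C \<and>
     inj_on i (carrier A) \<and> i ` carrier A = a_kernel B C p \<and> p ` carrier B = carrier C"

definition self_module :: "('r, 's) ring_scheme \<Rightarrow> ('r, 'r) module" where
  "self_module R = \<lparr>carrier = carrier R, monoid.mult = monoid.mult R, one = \<one>\<^bsub>R\<^esub>,
     ring.zero = \<zero>\<^bsub>R\<^esub>, ring.add = ring.add R, module.smult = monoid.mult R\<rparr>"


section \<open>Injective and projective modules\<close>

text \<open>
  HOL cannot quantify over all types inside a definition, so the lifting properties are stated for
  test modules carried by fixed types that are large enough. For injectivity, Baer's criterion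
  shows that test modules living in the type of the ring suffice (they include the inclusions of
  ideals into the ring). For projectivity of \<open>P\<close>, the tests include the canonical surjection onto
  \<open>P\<close> from the free module on the set \<open>carrier P\<close> (see \<open>free_mod\<close> below), whose splitting makes
  \<open>P\<close> a direct summand of a free module.
\<close>

definition injective_mod :: "('r, 's) ring_scheme \<Rightarrow> ('r, 'e) module \<Rightarrow> bool" where
  "injective_mod R E \<longleftrightarrow> module R E \<and>
     (\<forall>(A :: ('r, 'r) module) (B :: ('r, 'r) module). \<forall>i\<in>mod_Hom R A B. \<forall>f\<in>mod_Hom R A E.
        module R A \<and> module R B \<and> inj_on i (carrier A) \<longrightarrow>
        (\<exists>g\<in>mod_Hom R B E. compose (carrier A) g i = f))"

definition projective_mod :: "('r, 's) ring_scheme \<Rightarrow> ('r, 'p) module \<Rightarrow> bool" where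
  "projective_mod R P \<longleftrightarrow> module R P \<and>
     (\<forall>(B :: ('r, 'p \<Rightarrow> 'r) module) (C :: ('r, 'p) module).
        \<forall>q\<in>mod_Hom R B C. \<forall>f\<in>mod_Hom R P C.
        module R B \<and> module R C \<and> q ` carrier B = carrier C \<longrightarrow>
        (\<exists>g\<in>mod_Hom R P B. compose (carrier P) q g = f))"

definition projective_cover ::
  "('r, 's) ring_scheme \<Rightarrow> ('r, 'p) module \<Rightarrow> ('p \<Rightarrow> 'n) \<Rightarrow> ('r, 'n) module \<Rightarrow> bool" where
  "projective_cover R P p N \<longleftrightarrow> projective_mod R P \<and> module R N \<and>
     p \<in> mod_Hom R P N \<and> p ` carrier P = carrier N \<and>
     (\<forall>H. submodule H R P \<and> H <+>\<^bsub>P\<^esub> a_kernel P N p = carrier P \<longrightarrow> H = carrier P)"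

definition injective_hull ::
  "('r, 's) ring_scheme \<Rightarrow> ('r, 'n) module \<Rightarrow> ('n \<Rightarrow> 'e) \<Rightarrow> ('r, 'e) module \<Rightarrow> bool" where
  "injective_hull R N i E \<longleftrightarrow> injective_mod R E \<and> module R N \<and>
     i \<in> mod_Hom R N E \<and> inj_on i (carrier N) \<and>
     (\<forall>H. submodule H R E \<and> H \<inter> i ` carrier N = {\<zero>\<^bsub>E\<^esub>} \<longrightarrow> H = {\<zero>\<^bsub>E\<^esub>})"


section \<open>Syzygies and cosyzygies\<close>

text \<open>
  \<open>is_syzygy R n N M\<close> says \<open>M \<cong> \<Omega>\<^sup>n N\<close>, where \<open>\<Omega>\<^sup>n N\<close>, being defined only up to isomorphism, is
  treated as a relation. The iteration takes place in the type carrying \<open>M\<close>, starting from a copy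
  of \<open>N\<close> in that type. As this type is arbitrary, and \<open>M\<close> can be transported to any larger one,
  this is no restriction.
\<close>

definition syzygy_step ::
  "('r, 's) ring_scheme \<Rightarrow> ('r, 'm) module \<Rightarrow> ('r, 'm) module \<Rightarrow> bool" where
  "syzygy_step R N K \<longleftrightarrow> (\<exists>(P :: ('r, 'm) module) p i.
     projective_cover R P p N \<and> short_exact R K i P p N)"

definition cosyzygy_step ::
  "('r, 's) ring_scheme \<Rightarrow> ('r, 'm) module \<Rightarrow> ('r, 'm) module \<Rightarrow> bool" where
  "cosyzygy_step R N C \<longleftrightarrow> (\<exists>(E :: ('r, 'm) module) i p.
     injective_hull R N i E \<and> short_exact R N i E p C)"

definition is_syzygy ::
  "('r, 's) ring_scheme \<Rightarrow> int \<Rightarrow> ('r, 'n) module \<Rightarrow> ('r, 'm) module \<Rightarrow> bool" where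
  "is_syzygy R n N M \<longleftrightarrow> (\<exists>N' :: ('r, 'm) module. mod_iso R N N' \<and>
     (if n \<ge> 0 then (syzygy_step R ^^ nat n) N' M else (cosyzygy_step R ^^ nat (- n)) N' M))"


section \<open>Trace modules\<close>

text \<open>The sum of the submodules \<open>\<alpha>(A)\<close>, i.e.\ the set of all finite sums of their elements.\<close>

definition trace_module ::
  "('r, 's) ring_scheme \<Rightarrow> ('r, 'a) module \<Rightarrow> ('r, 'x) module \<Rightarrow> 'x set" where
  "trace_module R A Y = {\<Oplus>\<^bsub>Y\<^esub>\<alpha>\<in>S. \<alpha> (u \<alpha>) | S u.
     finite S \<and> S \<subseteq> mod_Hom R A Y \<and> u \<in> S \<rightarrow> carrier A}"


section \<open>The first Ext group\<close>

definition free_mod :: "('r, 's) ring_scheme \<Rightarrow> 'b set \<Rightarrow> ('r, 'b \<Rightarrow> 'r) module" where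
  "free_mod R B = \<lparr>
     carrier = {f. (\<forall>x\<in>B. f x \<in> carrier R) \<and> (\<forall>x. x \<notin> B \<longrightarrow> f x = \<zero>\<^bsub>R\<^esub>) \<and>
                   finite {x. f x \<noteq> \<zero>\<^bsub>R\<^esub>}},
     monoid.mult = undefined, one = undefined,
     ring.zero = (\<lambda>_. \<zero>\<^bsub>R\<^esub>), ring.add = (\<lambda>f g x. f x \<oplus>\<^bsub>R\<^esub> g x), module.smult = (\<lambda>a f x. a \<otimes>\<^bsub>R\<^esub> f x)\<rparr>"

text \<open>For \<open>B \<subseteq> carrier M\<close>, the homomorphism from the free module on \<open>B\<close> to \<open>M\<close> with \<open>e\<^sub>x \<mapsto> x\<close>.\<close>

definition free_eval ::
  "('r, 's) ring_scheme \<Rightarrow> ('r, 'm) module \<Rightarrow> 'm set \<Rightarrow> ('m \<Rightarrow> 'r) \<Rightarrow> 'm" where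
  "free_eval R M B = (\<lambda>f\<in>carrier (free_mod R B). \<Oplus>\<^bsub>M\<^esub>x\<in>{x. f x \<noteq> \<zero>\<^bsub>R\<^esub>}. f x \<odot>\<^bsub>M\<^esub> x)"

text \<open>
  The beginning \<open>F\<^sub>2 \<rightarrow> F\<^sub>1 \<rightarrow> F\<^sub>0 \<rightarrow> M \<rightarrow> 0\<close> of the canonical free resolution of \<open>M\<close>: \<open>F\<^sub>0\<close> is free on
  the set \<open>M\<close>, and each further \<open>F\<^sub>i\<close> is free on the kernel of the preceding map.
\<close>

definition res0 :: "('r, 's) ring_scheme \<Rightarrow> ('r, 'm) module \<Rightarrow> ('r, 'm \<Rightarrow> 'r) module" where
  "res0 R M = free_mod R (carrier M)"

definition res_ker0 :: "('r, 's) ring_scheme \<Rightarrow> ('r, 'm) module \<Rightarrow> ('m \<Rightarrow> 'r) set" where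
  "res_ker0 R M = a_kernel (res0 R M) M (free_eval R M (carrier M))"

definition res1 :: "('r, 's) ring_scheme \<Rightarrow> ('r, 'm) module \<Rightarrow> ('r, ('m \<Rightarrow> 'r) \<Rightarrow> 'r) module" where
  "res1 R M = free_mod R (res_ker0 R M)"

definition res_d1 :: "('r, 's) ring_scheme \<Rightarrow> ('r, 'm) module \<Rightarrow> (('m \<Rightarrow> 'r) \<Rightarrow> 'r) \<Rightarrow> ('m \<Rightarrow> 'r)"
  where "res_d1 R M = free_eval R (res0 R M) (res_ker0 R M)"

definition res_ker1 :: "('r, 's) ring_scheme \<Rightarrow> ('r, 'm) module \<Rightarrow> (('m \<Rightarrow> 'r) \<Rightarrow> 'r) set" where
  "res_ker1 R M = a_kernel (res1 R M) (res0 R M) (res_d1 R M)"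

definition res2 ::
  "('r, 's) ring_scheme \<Rightarrow> ('r, 'm) module \<Rightarrow> ('r, (('m \<Rightarrow> 'r) \<Rightarrow> 'r) \<Rightarrow> 'r) module" where
  "res2 R M = free_mod R (res_ker1 R M)"

definition res_d2 ::
  "('r, 's) ring_scheme \<Rightarrow> ('r, 'm) module \<Rightarrow> ((('m \<Rightarrow> 'r) \<Rightarrow> 'r) \<Rightarrow> 'r) \<Rightarrow> (('m \<Rightarrow> 'r) \<Rightarrow> 'r)"
  where "res_d2 R M = free_eval R (res1 R M) (res_ker1 R M)"

text \<open>The abelian group \<open>Hom\<^sub>R(M, N)\<close>, written as a \<open>monoid\<close> record so that \<open>Mod\<close> applies to it.\<close>

definition hom_group ::
  "('r, 's) ring_scheme \<Rightarrow> ('r, 'm) module \<Rightarrow> ('r, 'n) module \<Rightarrow> ('m \<Rightarrow> 'n) monoid" where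
  "hom_group R M N = \<lparr>carrier = mod_Hom R M N,
     monoid.mult = (\<lambda>f g. \<lambda>x\<in>carrier M. f x \<oplus>\<^bsub>N\<^esub> g x), one = (\<lambda>x\<in>carrier M. \<zero>\<^bsub>N\<^esub>)\<rparr>"

text \<open>
  \<open>Ext\<^sup>1\<^sub>R(M, N)\<close> is the cohomology of \<open>Hom(F\<^sub>0, N) \<rightarrow> Hom(F\<^sub>1, N) \<rightarrow> Hom(F\<^sub>2, N)\<close> at the middle term.
\<close>

definition cocycles1 ::
  "('r, 's) ring_scheme \<Rightarrow> ('r, 'm) module \<Rightarrow> ('r, 'n) module
     \<Rightarrow> ((('m \<Rightarrow> 'r) \<Rightarrow> 'r) \<Rightarrow> 'n) set" where
  "cocycles1 R M N = kernel (hom_group R (res1 R M) N) (hom_group R (res2 R M) N)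
     (\<lambda>g. compose (carrier (res2 R M)) g (res_d2 R M))"

definition coboundaries1 ::
  "('r, 's) ring_scheme \<Rightarrow> ('r, 'm) module \<Rightarrow> ('r, 'n) module
     \<Rightarrow> ((('m \<Rightarrow> 'r) \<Rightarrow> 'r) \<Rightarrow> 'n) set" where
  "coboundaries1 R M N =
     (\<lambda>h. compose (carrier (res1 R M)) h (res_d1 R M)) ` mod_Hom R (res0 R M) N"

definition Ext1 ::
  "('r, 's) ring_scheme \<Rightarrow> ('r, 'm) module \<Rightarrow> ('r, 'n) module
     \<Rightarrow> ((('m \<Rightarrow> 'r) \<Rightarrow> 'r) \<Rightarrow> 'n) set monoid" where
  "Ext1 R M N = (hom_group R (res1 R M) N)\<lparr>carrier := cocycles1 R M N\<rparr> Mod coboundaries1 R M N"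

definition rigid :: "('r, 's) ring_scheme \<Rightarrow> ('r, 'm) module \<Rightarrow> bool" where
  "rigid R M \<longleftrightarrow> carrier (Ext1 R M M) = {\<one>\<^bsub>Ext1 R M M\<^esub>}"


section \<open>The rings\<close>

definition local_ring :: "('r, 's) ring_scheme \<Rightarrow> bool" where
  "local_ring R \<longleftrightarrow> cring R \<and> (\<exists>!m. maximalideal m R)"

definition artinian_ring :: "('r, 's) ring_scheme \<Rightarrow> bool" where
  "artinian_ring R \<longleftrightarrow> cring R \<and>
     (\<forall>I :: nat \<Rightarrow> 'r set. (\<forall>n. ideal (I n) R \<and> I (Suc n) \<subseteq> I n) \<longrightarrow> (\<exists>k. \<forall>n\<ge>k. I n = I k))"

text \<open>A Noetherian commutative ring is Artinian Gorenstein iff it is injective as a module over itself.\<close>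

definition artinian_gorenstein_ring :: "('r, 's) ring_scheme \<Rightarrow> bool" where
  "artinian_gorenstein_ring R \<longleftrightarrow>
     cring R \<and> noetherian_ring R \<and> artinian_ring R \<and> injective_mod R (self_module R)"

end

theory Submission
  imports Defs
begin

text \<open>
  Let \<open>N\<close> be a trace submodule of \<open>Y\<close>. Every homomorphism \<open>N \<rightarrow> Y\<close> has its image in \<open>N\<close>, because
  \<open>N\<close> is the sum of the images of homomorphisms \<open>A \<rightarrow> N\<close> and these, composed with \<open>N \<rightarrow> Y\<close>, are
  again maps \<open>A \<rightarrow> Y\<close> (\<open>trace_module_invariant\<close>). Hence \<open>Hom(N, N) \<rightarrow> Hom(N, Y)\<close> is surjective and
  \<open>Hom(N, Y/N)\<close> embeds into \<open>Ext\<^sup>1(N, N)\<close>. If \<open>N\<close> is nonzero and proper, then over a local Artinian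
  ring \<open>Hom(N, Y/N)\<close> contains a nonzero map \<open>N \<rightarrow> k \<rightarrow> Y/N\<close>, where \<open>k\<close> is the residue field. So \<open>N\<close> is not
  rigid (\<open>trace_submodule_not_Ext1_vanishes\<close>).

  Rigidity does not change under syzygies and cosyzygies, because over a self-injective local
  Artinian ring projective and injective modules coincide. For \<open>0 \<rightarrow> K \<rightarrow> P \<rightarrow> N \<rightarrow> 0\<close> with \<open>P\<close> both
  projective and injective, \<open>Ext\<^sup>1(N, N)\<close> is \<open>Hom(K, N)\<close> modulo the maps that extend to \<open>P\<close>, while
  \<open>Ext\<^sup>1(K, K)\<close> is \<open>Hom(K, N)\<close> modulo the maps that lift to \<open>P\<close>. A map that lifts to \<open>P\<close> extends to \<open>P\<close>
  by injectivity, and one that extends to \<open>P\<close> lifts to \<open>P\<close> by projectivity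
  (\<open>Ext1_vanishes_of_syzygy\<close>, \<open>Ext1_vanishes_of_cosyzygy\<close>). Thus a rigid \<open>\<Omega>\<^sup>n N\<close> makes \<open>N\<close> rigid.

  The modules may be infinitely generated, so three classical facts are proved on the way: Baer's
  criterion (\<open>baer_extend\<close>), injectivity of free modules of any rank over a Noetherian
  self-injective ring (\<open>free_mod_baer\<close>), and projectivity of injective modules
  (\<open>baer_split_projective\<close>).

  A nonzero ideal \<open>I \<noteq> R\<close> fits the same argument with \<open>Y = R\<close>: by self-injectivity each homomorphism \<open>I \<rightarrow> R\<close>
  is multiplication by an element of \<open>R\<close>, so its image lies in \<open>I\<close> (\<open>ideal_invariant\<close>).
\<close>

section \<open>Linear maps\<close>

text \<open>
  Unlike the elements of \<open>mod_Hom\<close>, linear maps are unconstrained outside the carrier. They compose as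
  plain functions, and one map serves as a map on a module and on its submodules.
\<close>

definition linear_map ::
  "('r, 's) ring_scheme \<Rightarrow> ('r, 'm) module \<Rightarrow> ('r, 'n) module \<Rightarrow> ('m \<Rightarrow> 'n) \<Rightarrow> bool" where
  "linear_map R M N f \<longleftrightarrow> f \<in> carrier M \<rightarrow> carrier N \<and>
     (\<forall>x\<in>carrier M. \<forall>y\<in>carrier M. f (x \<oplus>\<^bsub>M\<^esub> y) = f x \<oplus>\<^bsub>N\<^esub> f y) \<and>
     (\<forall>a\<in>carrier R. \<forall>x\<in>carrier M. f (a \<odot>\<^bsub>M\<^esub> x) = a \<odot>\<^bsub>N\<^esub> f x)"

lemma linear_mapI:
  assumes "\<And>x. x \<in> carrier M \<Longrightarrow> f x \<in> carrier N"
    and "\<And>x y. x \<in> carrier M \<Longrightarrow> y \<in> carrier M \<Longrightarrow> f (x \<oplus>\<^bsub>M\<^esub> y) = f x \<oplus>\<^bsub>N\<^esub> f y"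
    and "\<And>a x. a \<in> carrier R \<Longrightarrow> x \<in> carrier M \<Longrightarrow> f (a \<odot>\<^bsub>M\<^esub> x) = a \<odot>\<^bsub>N\<^esub> f x"
  shows "linear_map R M N f"
  using assms by (auto simp: linear_map_def)

lemma linear_map_closed: "linear_map R M N f \<Longrightarrow> x \<in> carrier M \<Longrightarrow> f x \<in> carrier N"
  and linear_map_add: "linear_map R M N f \<Longrightarrow> x \<in> carrier M \<Longrightarrow> y \<in> carrier M \<Longrightarrow>
    f (x \<oplus>\<^bsub>M\<^esub> y) = f x \<oplus>\<^bsub>N\<^esub> f y"
  and linear_map_smult: "linear_map R M N f \<Longrightarrow> a \<in> carrier R \<Longrightarrow> x \<in> carrier M \<Longrightarrow>
    f (a \<odot>\<^bsub>M\<^esub> x) = a \<odot>\<^bsub>N\<^esub> f x"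
  by (auto simp: linear_map_def)

lemma mod_Hom_iff: "f \<in> mod_Hom R M N \<longleftrightarrow> linear_map R M N f \<and> f \<in> extensional (carrier M)"
  by (auto simp: mod_Hom_def linear_map_def PiE_def)

lemma linear_map_mod_Hom: "f \<in> mod_Hom R M N \<Longrightarrow> linear_map R M N f"
  by (simp add: mod_Hom_iff)

lemma linear_map_cong:
  assumes "linear_map R M N f" "module R M" "\<And>x. x \<in> carrier M \<Longrightarrow> g x = f x"
  shows "linear_map R M N g"
proof -
  interpret M: module R M by fact
  show ?thesis using assms(1,3) by (auto simp: linear_map_def)
qed

lemma restrict_mod_Hom:
  assumes "linear_map R M N f" "module R M"
  shows "restrict f (carrier M) \<in> mod_Hom R M N"
  using linear_map_cong[OF assms, of "restrict f (carrier M)"] by (simp add: mod_Hom_iff)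

lemma linear_map_comp:
  assumes "linear_map R A B f" "linear_map R B C g"
  shows "linear_map R A C (\<lambda>x. g (f x))"
  using assms by (auto simp: linear_map_def Pi_def)

lemma linear_map_id: "linear_map R M M (\<lambda>x. x)"
  by (auto simp: linear_map_def)

lemma linear_map_zero:
  assumes "module R M" "module R N" "linear_map R M N f"
  shows "f \<zero>\<^bsub>M\<^esub> = \<zero>\<^bsub>N\<^esub>"
proof -
  interpret M: module R M by fact
  interpret N: module R N by fact
  have "f (\<zero>\<^bsub>R\<^esub> \<odot>\<^bsub>M\<^esub> \<zero>\<^bsub>M\<^esub>) = \<zero>\<^bsub>R\<^esub> \<odot>\<^bsub>N\<^esub> f \<zero>\<^bsub>M\<^esub>"
    using linear_map_smult[OF assms(3)] by blast
  then show ?thesis using linear_map_closed[OF assms(3)] by simp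
qed

lemma linear_map_minus:
  assumes "module R M" "module R N" "linear_map R M N f" "x \<in> carrier M"
  shows "f (\<ominus>\<^bsub>M\<^esub> x) = \<ominus>\<^bsub>N\<^esub> f x"
proof -
  interpret M: module R M by fact
  interpret N: module R N by fact
  have "f ((\<ominus>\<^bsub>R\<^esub> \<one>\<^bsub>R\<^esub>) \<odot>\<^bsub>M\<^esub> x) = (\<ominus>\<^bsub>R\<^esub> \<one>\<^bsub>R\<^esub>) \<odot>\<^bsub>N\<^esub> f x"
    using linear_map_smult[OF assms(3)] assms(4) by blast
  then show ?thesis using linear_map_closed[OF assms(3,4)] assms(4)
    by (simp add: M.smult_l_minus N.smult_l_minus)
qed

lemma linear_map_diff:
  assumes "module R M" "module R N" "linear_map R M N f" "x \<in> carrier M" "y \<in> carrier M"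
  shows "f (x \<ominus>\<^bsub>M\<^esub> y) = f x \<ominus>\<^bsub>N\<^esub> f y"
proof -
  interpret M: module R M by fact
  interpret N: module R N by fact
  show ?thesis using assms
    by (simp add: a_minus_def linear_map_add[OF assms(3)] linear_map_minus[OF assms(1-3)])
qed

lemma linear_map_plus:
  assumes "module R M" "module R N" "linear_map R M N f" "linear_map R M N g"
  shows "linear_map R M N (\<lambda>x. f x \<oplus>\<^bsub>N\<^esub> g x)"
proof -
  interpret M: module R M by fact
  interpret N: module R N by fact
  note cl = linear_map_closed[OF assms(3)] linear_map_closed[OF assms(4)]
  show ?thesis
    by (rule linear_mapI)
      (simp_all add: cl linear_map_add[OF assms(3)] linear_map_add[OF assms(4)]
        linear_map_smult[OF assms(3)] linear_map_smult[OF assms(4)] N.a_ac N.smult_r_distr)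
qed

lemma linear_map_sub:
  assumes "module R M" "module R N" "linear_map R M N f" "linear_map R M N g"
  shows "linear_map R M N (\<lambda>x. f x \<ominus>\<^bsub>N\<^esub> g x)"
proof -
  interpret M: module R M by fact
  interpret N: module R N by fact
  note cl = linear_map_closed[OF assms(3)] linear_map_closed[OF assms(4)]
  have "linear_map R M N (\<lambda>x. \<ominus>\<^bsub>N\<^esub> g x)"
    by (rule linear_mapI)
      (simp_all add: cl linear_map_add[OF assms(4)]
        linear_map_smult[OF assms(4)] N.minus_add N.smult_r_minus)
  from linear_map_plus[OF assms(1-3) this] show ?thesis by (simp add: a_minus_def)
qed

lemma linear_map_finsum:
  assumes "module R M" "module R N" "linear_map R M N f" "finite S" "v \<in> S \<rightarrow> carrier M"
  shows "f (\<Oplus>\<^bsub>M\<^esub>x\<in>S. v x) = (\<Oplus>\<^bsub>N\<^esub>x\<in>S. f (v x))"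
proof -
  interpret M: module R M by fact
  interpret N: module R N by fact
  show ?thesis using assms(4,5)
  proof (induction S)
    case empty
    then show ?case using linear_map_zero[OF assms(1-3)] by simp
  next
    case (insert a S)
    have 1: "v a \<in> carrier M" "v \<in> S \<rightarrow> carrier M" using insert.prems by auto
    have 2: "(\<lambda>x. f (v x)) \<in> S \<rightarrow> carrier N" "f (v a) \<in> carrier N"
      using 1 linear_map_closed[OF assms(3)] by auto
    show ?case using insert 1 2
      by (simp add: M.finsum_insert N.finsum_insert linear_map_add[OF assms(3)])
  qed
qed

lemma a_kernel_iff: "x \<in> a_kernel M N f \<longleftrightarrow> x \<in> carrier M \<and> f x = \<zero>\<^bsub>N\<^esub>"
  by (simp add: a_kernel_def')

lemma kernel_submodule:
  assumes "module R M" "module R N" "linear_map R M N f"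
  shows "submodule (a_kernel M N f) R M"
proof -
  interpret M: module R M by fact
  interpret N: module R N by fact
  show ?thesis
    by (rule M.submoduleI)
      (auto simp: a_kernel_iff linear_map_zero[OF assms] linear_map_minus[OF assms]
        linear_map_add[OF assms(3)] linear_map_smult[OF assms(3)])
qed

lemma preimage_submodule:
  assumes "module R M" "module R N" "linear_map R M N f" "submodule H R N"
  shows "submodule {x \<in> carrier M. f x \<in> H} R M"
proof -
  interpret M: module R M by fact
  interpret N: module R N by fact
  note H = N.submoduleE[OF assms(4)]
  have "\<zero>\<^bsub>N\<^esub> \<in> H" using subgroup.one_closed[OF submodule.axioms(1)[OF assms(4)]] by simp
  then show ?thesis
    by (intro M.submoduleI) (auto simp: linear_map_zero[OF assms(1-3)] linear_map_minus[OF assms(1-3)]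
      linear_map_add[OF assms(3)] linear_map_smult[OF assms(3)] H)
qed

lemma image_submodule:
  assumes "module R M" "module R N" "linear_map R M N f"
  shows "submodule (f ` carrier M) R N"
proof -
  interpret M: module R M by fact
  interpret N: module R N by fact
  show ?thesis
  proof (rule N.submoduleI)
    show "f ` carrier M \<subseteq> carrier N" using linear_map_closed[OF assms(3)] by auto
    show "\<zero>\<^bsub>N\<^esub> \<in> f ` carrier M" 
      using linear_map_zero[OF assms] M.zero_closed by (auto intro: rev_image_eqI)
    show "\<ominus>\<^bsub>N\<^esub> a \<in> f ` carrier M" if "a \<in> f ` carrier M" for a
      using that by (auto simp: linear_map_minus[OF assms, symmetric])
    show "a \<oplus>\<^bsub>N\<^esub> b \<in> f ` carrier M" if "a \<in> f ` carrier M" "b \<in> f ` carrier M" for a b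
      using that by (auto simp: linear_map_add[OF assms(3), symmetric])
    show "a \<odot>\<^bsub>N\<^esub> b \<in> f ` carrier M" if "a \<in> carrier R" "b \<in> f ` carrier M" for a b
      using that by (auto simp: linear_map_smult[OF assms(3), symmetric])
  qed
qed

lemma submodule_module: "module R M \<Longrightarrow> submodule H R M \<Longrightarrow> module R (M\<lparr>carrier := H\<rparr>)"
  by (rule submodule.submodule_is_module)

lemma linear_map_subset:
  assumes "linear_map R M N f" "H \<subseteq> carrier M"
  shows "linear_map R (M\<lparr>carrier := H\<rparr>) N f"
  using assms by (intro linear_mapI)
    (auto simp: subset_iff linear_map_closed[OF assms(1)] linear_map_add[OF assms(1)] linear_map_smult[OF assms(1)])

lemma linear_map_codomain:
  assumes "linear_map R M N f" "f ` carrier M \<subseteq> H"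
  shows "linear_map R M (N\<lparr>carrier := H\<rparr>) f"
  using assms by (auto simp: linear_map_def)

lemma linear_map_codomain_superset:
  assumes "linear_map R M (N\<lparr>carrier := H\<rparr>) f" "H \<subseteq> carrier N"
  shows "linear_map R M N f"
  using assms by (auto simp: linear_map_def)

lemma minus_eq_zero_iff:
  assumes "module R M" "x \<in> carrier M" "y \<in> carrier M"
  shows "x \<ominus>\<^bsub>M\<^esub> y = \<zero>\<^bsub>M\<^esub> \<longleftrightarrow> x = y"
proof -
  interpret M: module R M by fact
  show ?thesis
  proof
    assume "x \<ominus>\<^bsub>M\<^esub> y = \<zero>\<^bsub>M\<^esub>"
    then have "x = \<ominus>\<^bsub>M\<^esub> (\<ominus>\<^bsub>M\<^esub> y)"
      using assms(2,3) M.minus_equality[of x "\<ominus>\<^bsub>M\<^esub> y"] by (simp add: a_minus_def)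
    then show "x = y" using assms(3) by simp
  qed (use assms(3) in \<open>simp add: a_minus_def M.r_neg\<close>)
qed

lemma linear_map_injI:
  assumes "module R M" "module R N" "linear_map R M N f"
    and "\<And>x. x \<in> carrier M \<Longrightarrow> f x = \<zero>\<^bsub>N\<^esub> \<Longrightarrow> x = \<zero>\<^bsub>M\<^esub>"
  shows "inj_on f (carrier M)"
proof (rule inj_onI)
  interpret M: module R M by fact
  fix x y assume xy: "x \<in> carrier M" "y \<in> carrier M" "f x = f y"
  have "f (x \<ominus>\<^bsub>M\<^esub> y) = \<zero>\<^bsub>N\<^esub>"
    using xy by (simp add: linear_map_diff[OF assms(1-3)] minus_eq_zero_iff[OF assms(2)]
      linear_map_closed[OF assms(3)])
  then have "x \<ominus>\<^bsub>M\<^esub> y = \<zero>\<^bsub>M\<^esub>" using assms(4) xy by blast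
  then show "x = y" using minus_eq_zero_iff[OF assms(1)] xy by blast
qed

lemma factor_through_surjection:
  assumes "module R P" "module R N" "module R B" "linear_map R P N p" "p ` carrier P = carrier N"
    and g: "linear_map R P B g"
    and ker: "\<And>x. x \<in> carrier P \<Longrightarrow> p x = \<zero>\<^bsub>N\<^esub> \<Longrightarrow> g x = \<zero>\<^bsub>B\<^esub>"
  obtains d where "linear_map R N B d" "\<And>x. x \<in> carrier P \<Longrightarrow> d (p x) = g x"
proof -
  interpret P: module R P by fact
  interpret N: module R N by fact
  have wd: "g x = g y" if xy: "x \<in> carrier P" "y \<in> carrier P" "p x = p y" for x y
  proof -
    have "p (x \<ominus>\<^bsub>P\<^esub> y) = \<zero>\<^bsub>N\<^esub>"
      using xy by (simp add: linear_map_diff[OF assms(1,2,4)] minus_eq_zero_iff[OF assms(2)]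
        linear_map_closed[OF assms(4)])
    then have "g (x \<ominus>\<^bsub>P\<^esub> y) = \<zero>\<^bsub>B\<^esub>" using ker xy by blast
    then show ?thesis
      using xy by (simp add: linear_map_diff[OF assms(1,3) g] minus_eq_zero_iff[OF assms(3)]
        linear_map_closed[OF g])
  qed
  define d where "d n = g (SOME x. x \<in> carrier P \<and> p x = n)" for n
  have dp: "d (p x) = g x" if "x \<in> carrier P" for x
  proof -
    have "(SOME z. z \<in> carrier P \<and> p z = p x) \<in> carrier P \<and> p (SOME z. z \<in> carrier P \<and> p z = p x) = p x"
      by (rule someI[where x = x]) (simp add: that)
    then show ?thesis unfolding d_def using wd that by metis
  qed
  have "linear_map R N B d"
  proof (rule linear_mapI)
    show "d n \<in> carrier B" if "n \<in> carrier N" for n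
      using that linear_map_closed[OF g] dp unfolding assms(5)[symmetric] by auto
    show "d (n \<oplus>\<^bsub>N\<^esub> n') = d n \<oplus>\<^bsub>B\<^esub> d n'" if "n \<in> carrier N" "n' \<in> carrier N" for n n'
      using that unfolding assms(5)[symmetric]
      by (auto simp: linear_map_add[OF assms(4), symmetric] dp linear_map_add[OF g])
    show "d (a \<odot>\<^bsub>N\<^esub> n) = a \<odot>\<^bsub>B\<^esub> d n" if "a \<in> carrier R" "n \<in> carrier N" for a n
      using that unfolding assms(5)[symmetric]
      by (auto simp: linear_map_smult[OF assms(4), symmetric] dp linear_map_smult[OF g])
  qed
  with dp show ?thesis using that by blast
qed

lemma factor_through_injection:
  assumes "module R P" "module R A" "module R B" "linear_map R A B i" "inj_on i (carrier A)"
    and g: "linear_map R P B g" "g ` carrier P \<subseteq> i ` carrier A"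
  obtains h where "linear_map R P A h" "\<And>x. x \<in> carrier P \<Longrightarrow> i (h x) = g x"
proof -
  interpret P: module R P by fact
  interpret A: module R A by fact
  define h where "h x = inv_into (carrier A) i (g x)" for x
  have h: "h x \<in> carrier A" "i (h x) = g x" if "x \<in> carrier P" for x
    using g(2) that unfolding h_def by (auto intro!: inv_into_into f_inv_into_f)
  have eqI: "a = b" if "i a = i b" "a \<in> carrier A" "b \<in> carrier A" for a b
    using that assms(5) by (meson inj_onD)
  have "linear_map R P A h"
    by (rule linear_mapI, simp add: h)
      (rule eqI, simp_all add: h linear_map_add[OF g(1)] linear_map_add[OF assms(4)]
          linear_map_smult[OF g(1)] linear_map_smult[OF assms(4)])+
  with h show ?thesis using that by blast
qed

section \<open>Free modules\<close>

text \<open>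
  The homomorphism from the free module with \<open>e\<^sub>x \<mapsto> u x\<close>. For \<open>u = id\<close> it is \<open>free_eval\<close> on the carrier
  of the free module (\<open>free_eval_eq\<close>).
\<close>

definition free_lift ::
  "('r, 's) ring_scheme \<Rightarrow> ('r, 'm) module \<Rightarrow> ('b \<Rightarrow> 'm) \<Rightarrow> ('b \<Rightarrow> 'r) \<Rightarrow> 'm" where
  "free_lift R M u f = (\<Oplus>\<^bsub>M\<^esub>x\<in>{x. f x \<noteq> \<zero>\<^bsub>R\<^esub>}. f x \<odot>\<^bsub>M\<^esub> u x)"

definition unit_vector :: "('r, 's) ring_scheme \<Rightarrow> 'b \<Rightarrow> 'b \<Rightarrow> 'r" where
  "unit_vector R x = (\<lambda>y. if y = x then \<one>\<^bsub>R\<^esub> else \<zero>\<^bsub>R\<^esub>)"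

lemma free_mod_simps [simp]:
  "\<zero>\<^bsub>free_mod R B\<^esub> = (\<lambda>_. \<zero>\<^bsub>R\<^esub>)"
  "f \<oplus>\<^bsub>free_mod R B\<^esub> g = (\<lambda>x. f x \<oplus>\<^bsub>R\<^esub> g x)"
  "a \<odot>\<^bsub>free_mod R B\<^esub> f = (\<lambda>x. a \<otimes>\<^bsub>R\<^esub> f x)"
  by (simp_all add: free_mod_def)

lemma free_mod_carrier:
  "f \<in> carrier (free_mod R B) \<longleftrightarrow>
    (\<forall>x\<in>B. f x \<in> carrier R) \<and> (\<forall>x. x \<notin> B \<longrightarrow> f x = \<zero>\<^bsub>R\<^esub>) \<and> finite {x. f x \<noteq> \<zero>\<^bsub>R\<^esub>}"
  by (simp add: free_mod_def)

lemma (in cring) free_mod_closed: "f \<in> carrier (free_mod R B) \<Longrightarrow> f x \<in> carrier R"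
  by (cases "x \<in> B") (auto simp: free_mod_carrier)

lemma (in cring) free_mod_module: "module R (free_mod R B)"
proof (rule moduleI)
  let ?F = "free_mod R B"
  have add: "(\<lambda>x. f x \<oplus> g x) \<in> carrier ?F" if "f \<in> carrier ?F" "g \<in> carrier ?F" for f g
  proof -
    have "{x. f x \<oplus> g x \<noteq> \<zero>} \<subseteq> {x. f x \<noteq> \<zero>} \<union> {x. g x \<noteq> \<zero>}" by auto
    then have "finite {x. f x \<oplus> g x \<noteq> \<zero>}"
      using that unfolding free_mod_carrier by (meson finite_UnI finite_subset)
    then show ?thesis using that by (auto simp: free_mod_carrier)
  qed
  have smult: "(\<lambda>x. a \<otimes> f x) \<in> carrier ?F" if "a \<in> carrier R" "f \<in> carrier ?F" for a f
  proof -
    have "{x. a \<otimes> f x \<noteq> \<zero>} \<subseteq> {x. f x \<noteq> \<zero>}" using that by auto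
    then have "finite {x. a \<otimes> f x \<noteq> \<zero>}"
      using that unfolding free_mod_carrier by (meson finite_subset)
    then show ?thesis using that by (auto simp: free_mod_carrier)
  qed
  have zero: "(\<lambda>x. \<zero>) \<in> carrier ?F" by (simp add: free_mod_carrier)
  show "cring R" by (rule is_cring)
  show "abelian_group ?F"
  proof (rule abelian_groupI)
    show "\<exists>g\<in>carrier ?F. g \<oplus>\<^bsub>?F\<^esub> f = \<zero>\<^bsub>?F\<^esub>" if "f \<in> carrier ?F" for f
    proof
      show "(\<lambda>x. (\<ominus> \<one>) \<otimes> f x) \<in> carrier ?F" by (rule smult) (use that in auto)
      show "(\<lambda>x. (\<ominus> \<one>) \<otimes> f x) \<oplus>\<^bsub>?F\<^esub> f = \<zero>\<^bsub>?F\<^esub>"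
        using free_mod_closed[OF that] by (auto simp: l_minus l_neg)
    qed
  qed (auto simp: add zero free_mod_closed a_ac)
  show "a \<odot>\<^bsub>?F\<^esub> f \<in> carrier ?F" if "a \<in> carrier R" "f \<in> carrier ?F" for a f
    using smult that by simp
qed (auto simp: free_mod_closed l_distr r_distr m_assoc)

lemma (in cring) unit_vector_closed: "x \<in> B \<Longrightarrow> unit_vector R x \<in> carrier (free_mod R B)"
  by (auto simp: free_mod_carrier unit_vector_def)

lemma (in cring) free_mod_mono:
  "B \<subseteq> C \<Longrightarrow> f \<in> carrier (free_mod R B) \<Longrightarrow> f \<in> carrier (free_mod R C)"
  unfolding free_mod_carrier by (metis subsetD zero_closed)

text \<open>
  Elements with different supports can be compared once their sums run over a common finite set.
\<close>

lemma free_lift_superset: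
  fixes R (structure)
  assumes M: "module R M" and "f \<in> carrier (free_mod R B)" "u \<in> B \<rightarrow> carrier M" "finite S" "{x. f x \<noteq> \<zero>} \<subseteq> S" "S \<subseteq> B"
  shows "free_lift R M u f = (\<Oplus>\<^bsub>M\<^esub>x\<in>S. f x \<odot>\<^bsub>M\<^esub> u x)"
proof -
  interpret M: module R M by fact
  show ?thesis
    unfolding free_lift_def
    by (rule M.add.finprod_mono_neutral_cong_left)
      (use assms(3-6) M.R.free_mod_closed[OF assms(2)] in \<open>auto simp: Pi_iff subset_iff\<close>)
qed

lemma free_lift_linear:
  fixes R (structure)
  assumes M: "module R M" and u: "u \<in> B \<rightarrow> carrier M"
  shows "linear_map R (free_mod R B) M (free_lift R M u)"
proof (rule linear_mapI)
  let ?F = "free_mod R B"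
  interpret M: module R M by fact
  interpret F: module R ?F by (rule M.R.free_mod_module)
  have sB: "{x. f x \<noteq> \<zero>} \<subseteq> B" and fin: "finite {x. f x \<noteq> \<zero>}" if "f \<in> carrier ?F" for f
    using that by (auto simp: free_mod_carrier)
  have cl: "(\<lambda>x. f x \<odot>\<^bsub>M\<^esub> u x) \<in> S \<rightarrow> carrier M" if "S \<subseteq> B" "f \<in> carrier ?F" for f S
    using that(1) u M.R.free_mod_closed[OF that(2)] by (auto simp: Pi_iff subset_iff)
  show "free_lift R M u f \<in> carrier M" if "f \<in> carrier ?F" for f
    unfolding free_lift_def by (rule M.finsum_closed, rule cl[OF sB that], rule that)
  show "free_lift R M u (f \<oplus>\<^bsub>?F\<^esub> g) = free_lift R M u f \<oplus>\<^bsub>M\<^esub> free_lift R M u g"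
    if f: "f \<in> carrier ?F" and g: "g \<in> carrier ?F" for f g
  proof -
    let ?S = "{x. f x \<noteq> \<zero>} \<union> {x. g x \<noteq> \<zero>}"
    have S: "finite ?S" "?S \<subseteq> B" using sB fin f g by auto
    have fg: "f \<oplus>\<^bsub>?F\<^esub> g \<in> carrier ?F" using f g by (rule F.a_closed)
    have "free_lift R M u (f \<oplus>\<^bsub>?F\<^esub> g) = (\<Oplus>\<^bsub>M\<^esub>x\<in>?S. (f x \<oplus> g x) \<odot>\<^bsub>M\<^esub> u x)"
      using free_lift_superset[OF M fg u S(1) _ S(2)] by fastforce
    also have "\<dots> = (\<Oplus>\<^bsub>M\<^esub>x\<in>?S. f x \<odot>\<^bsub>M\<^esub> u x \<oplus>\<^bsub>M\<^esub> g x \<odot>\<^bsub>M\<^esub> u x)"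
      using S(2) u f g
      by (intro M.finsum_cong') (auto simp: M.R.free_mod_closed M.smult_l_distr subset_iff Pi_iff)
    also have "\<dots> = (\<Oplus>\<^bsub>M\<^esub>x\<in>?S. f x \<odot>\<^bsub>M\<^esub> u x) \<oplus>\<^bsub>M\<^esub> (\<Oplus>\<^bsub>M\<^esub>x\<in>?S. g x \<odot>\<^bsub>M\<^esub> u x)"
      by (rule M.finsum_addf[OF cl cl]) (use S f g in auto)
    also have "\<dots> = free_lift R M u f \<oplus>\<^bsub>M\<^esub> free_lift R M u g"
      using free_lift_superset[OF M f u S(1) _ S(2)] free_lift_superset[OF M g u S(1) _ S(2)] by auto
    finally show ?thesis .
  qed
  show "free_lift R M u (a \<odot>\<^bsub>?F\<^esub> f) = a \<odot>\<^bsub>M\<^esub> free_lift R M u f"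
    if a: "a \<in> carrier R" and f: "f \<in> carrier ?F" for a f
  proof -
    let ?S = "{x. f x \<noteq> \<zero>}"
    have af: "a \<odot>\<^bsub>?F\<^esub> f \<in> carrier ?F" using a f by (rule F.smult_closed)
    have "free_lift R M u (a \<odot>\<^bsub>?F\<^esub> f) = (\<Oplus>\<^bsub>M\<^esub>x\<in>?S. (a \<otimes> f x) \<odot>\<^bsub>M\<^esub> u x)"
      using free_lift_superset[OF M af u fin[OF f] _ sB[OF f]] a by fastforce
    also have "\<dots> = (\<Oplus>\<^bsub>M\<^esub>x\<in>?S. a \<odot>\<^bsub>M\<^esub> (f x \<odot>\<^bsub>M\<^esub> u x))"
      using a sB[OF f] u f
      by (intro M.finsum_cong') (auto simp: M.R.free_mod_closed M.smult_assoc1 subset_iff Pi_iff)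
    also have "\<dots> = a \<odot>\<^bsub>M\<^esub> free_lift R M u f"
      unfolding free_lift_def
      by (rule M.finsum_smult_ldistr[OF fin[OF f] a cl[OF sB[OF f] f], symmetric])
    finally show ?thesis .
  qed
qed

lemma free_lift_unit_vector:
  assumes M: "module R M" and x: "x \<in> B" and "u \<in> B \<rightarrow> carrier M"
  shows "free_lift R M u (unit_vector R x) = u x"
proof -
  interpret M: module R M by fact
  have "free_lift R M u (unit_vector R x) = (\<Oplus>\<^bsub>M\<^esub>y\<in>{x}. unit_vector R x y \<odot>\<^bsub>M\<^esub> u y)"
    using M.R.unit_vector_closed[OF x] by (rule free_lift_superset[OF M])
      (use assms in \<open>auto simp: unit_vector_def\<close>)
  also have "\<dots> = u x"
    using assms by (subst M.finsum_insert) (auto simp: unit_vector_def Pi_iff)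
  finally show ?thesis .
qed

lemma free_lift_comp:
  assumes "module R M" "module R N" "linear_map R M N g" "u \<in> B \<rightarrow> carrier M"
    "f \<in> carrier (free_mod R B)"
  shows "g (free_lift R M u f) = free_lift R N (\<lambda>x. g (u x)) f"
proof -
  interpret M: module R M by fact
  interpret N: module R N by fact
  have S: "{x. f x \<noteq> \<zero>\<^bsub>R\<^esub>} \<subseteq> B" "finite {x. f x \<noteq> \<zero>\<^bsub>R\<^esub>}"
    using assms(5) by (auto simp: free_mod_carrier)
  note fcl = M.R.free_mod_closed[OF assms(5)]
  have u: "u x \<in> carrier M" if "f x \<noteq> \<zero>\<^bsub>R\<^esub>" for x using that S assms(4) by auto
  have "g (free_lift R M u f) = (\<Oplus>\<^bsub>N\<^esub>x\<in>{x. f x \<noteq> \<zero>\<^bsub>R\<^esub>}. g (f x \<odot>\<^bsub>M\<^esub> u x))"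
    unfolding free_lift_def
    by (rule linear_map_finsum[OF assms(1-3) S(2)]) (use u fcl in auto)
  also have "\<dots> = free_lift R N (\<lambda>x. g (u x)) f"
    unfolding free_lift_def
    by (rule N.finsum_cong')
      (use u fcl linear_map_smult[OF assms(3)] linear_map_closed[OF assms(3)] in auto)
  finally show ?thesis .
qed

lemma free_lift_cong:
  assumes M: "module R M" and f: "f \<in> carrier (free_mod R B)" and u: "u \<in> B \<rightarrow> carrier M"
    and uv: "\<And>x. x \<in> B \<Longrightarrow> v x = u x"
  shows "free_lift R M v f = free_lift R M u f"
  unfolding free_lift_def
proof (rule abelian_monoid.finsum_cong')
  interpret M: module R M by (rule M)
  show "abelian_monoid M" by (rule M.abelian_monoid_axioms)
  have "{x. f x \<noteq> \<zero>\<^bsub>R\<^esub>} \<subseteq> B" using f by (auto simp: free_mod_carrier)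
  then show "(\<lambda>x. f x \<odot>\<^bsub>M\<^esub> u x) \<in> {x. f x \<noteq> \<zero>\<^bsub>R\<^esub>} \<rightarrow> carrier M"
    and "\<And>i. i \<in> {x. f x \<noteq> \<zero>\<^bsub>R\<^esub>} \<Longrightarrow> f i \<odot>\<^bsub>M\<^esub> v i = f i \<odot>\<^bsub>M\<^esub> u i"
    using M.R.free_mod_closed[OF f] u uv by auto
qed auto

lemma free_eval_eq:
  "f \<in> carrier (free_mod R B) \<Longrightarrow> free_eval R M B f = free_lift R M (\<lambda>x. x) f"
  by (simp add: free_eval_def free_lift_def)

lemma free_eval_linear:
  assumes M: "module R M" and "B \<subseteq> carrier M"
  shows "linear_map R (free_mod R B) M (free_eval R M B)"
proof -
  interpret M: module R M by fact
  show ?thesis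
    by (rule linear_map_cong[OF free_lift_linear[OF M, of "\<lambda>x. x"] M.R.free_mod_module free_eval_eq])
      (use assms in auto)
qed

lemma free_eval_unit_vector:
  assumes M: "module R M" and "B \<subseteq> carrier M" "x \<in> B"
  shows "free_eval R M B (unit_vector R x) = x"
proof -
  interpret M: module R M by fact
  show ?thesis
    using free_lift_unit_vector[OF M, of x B "\<lambda>x. x"] assms
      free_eval_eq[OF M.R.unit_vector_closed, of x B M] by auto
qed

section \<open>Injective modules and Baer's criterion\<close>

lemma self_module_simps [simp]:
  "carrier (self_module R) = carrier R"
  "\<zero>\<^bsub>self_module R\<^esub> = \<zero>\<^bsub>R\<^esub>"
  "x \<oplus>\<^bsub>self_module R\<^esub> y = x \<oplus>\<^bsub>R\<^esub> y"
  "a \<odot>\<^bsub>self_module R\<^esub> x = a \<otimes>\<^bsub>R\<^esub> x"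
  by (simp_all add: self_module_def)

lemma (in cring) self_module_module: "module R (self_module R)"
proof (rule moduleI)
  show "abelian_group (self_module R)"
  proof (rule abelian_groupI)
    show "\<exists>y\<in>carrier (self_module R). y \<oplus>\<^bsub>self_module R\<^esub> x = \<zero>\<^bsub>self_module R\<^esub>"
      if "x \<in> carrier (self_module R)" for x
      using that by (intro bexI[of _ "\<ominus> x"]) (auto simp: l_neg)
  qed (auto simp: a_ac)
qed (auto simp: is_cring l_distr r_distr m_assoc)

lemma (in cring) linear_map_cyclic:
  assumes "module R M" "x \<in> carrier M"
  shows "linear_map R (self_module R) M (\<lambda>r. r \<odot>\<^bsub>M\<^esub> x)"
proof -
  interpret M: module R M by fact
  show ?thesis by (rule linear_mapI) (simp_all add: assms(2) M.smult_l_distr M.smult_assoc1)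
qed

lemma (in cring) ideal_iff_submodule: "ideal I R \<longleftrightarrow> submodule I R (self_module R)"
proof
  interpret S: module R "self_module R" by (rule self_module_module)
  assume "ideal I R"
  then interpret I: ideal I R .
  show "submodule I R (self_module R)"
  proof (rule S.submoduleI)
    show "\<ominus>\<^bsub>self_module R\<^esub> a \<in> I" if "a \<in> I" for a
    proof -
      have "\<ominus>\<^bsub>self_module R\<^esub> a = (\<ominus> \<one>) \<odot>\<^bsub>self_module R\<^esub> a"
        using that I.Icarr S.smult_l_minus[of \<one> a] by simp
      then show ?thesis using that I.I_l_closed by simp
    qed
  qed (auto simp: I.Icarr I.I_l_closed I.a_closed)
next
  interpret S: module R "self_module R" by (rule self_module_module)
  assume I: "submodule I R (self_module R)"
  note E = S.submoduleE[OF I]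
  have neg: "\<ominus> a \<in> I" if "a \<in> I" for a
    using E(4)[of "\<ominus> \<one>" a] E(1) that by (auto simp: l_minus subset_iff)
  have sub: "subgroup I (add_monoid R)"
    by (rule add.subgroupI) (use E(1,2,5) neg in \<open>auto simp: a_inv_def[symmetric]\<close>)
  show "ideal I R"
  proof (rule idealI[OF ring_axioms sub])
    fix a x assume ax: "a \<in> I" "x \<in> carrier R"
    show "x \<otimes> a \<in> I" using E(4)[of x a] ax by simp
    then show "a \<otimes> x \<in> I" using m_comm[of a x] E(1) ax by auto
  qed
qed

text \<open>
  Injectivity tested on ideals. A map \<open>g\<close> from an ideal extends to \<open>R\<close> iff it is multiplication by
  some \<open>w\<close>, namely by the value of the extension at \<open>\<one>\<close>.
\<close>

definition baer :: "('r, 's) ring_scheme \<Rightarrow> ('r, 'e) module \<Rightarrow> bool" where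
  "baer R E \<longleftrightarrow> (\<forall>I g. ideal I R \<and> linear_map R ((self_module R)\<lparr>carrier := I\<rparr>) E g \<longrightarrow>
     (\<exists>w\<in>carrier E. \<forall>r\<in>I. g r = r \<odot>\<^bsub>E\<^esub> w))"

lemma injective_mod_baer:
  fixes R (structure)
  assumes "cring R" "injective_mod R E"
  shows "baer R E"
  unfolding baer_def
proof (intro allI impI, elim conjE)
  interpret cring R by fact
  interpret S: module R "self_module R" by (rule self_module_module)
  let ?S = "self_module R"
  fix I g assume I: "ideal I R" and g: "linear_map R (?S\<lparr>carrier := I\<rparr>) E g"
  let ?I = "?S\<lparr>carrier := I\<rparr>"
  interpret I: ideal I R by fact
  have mI: "module R ?I"
    using I submodule_module[OF self_module_module] ideal_iff_submodule by blast
  have incl: "linear_map R ?I ?S (\<lambda>x. x)"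
    by (rule linear_map_subset[OF linear_map_id]) (auto simp: I.Icarr)
  have i: "restrict (\<lambda>x. x) I \<in> mod_Hom R ?I ?S"
    using restrict_mod_Hom[OF incl mI] by simp
  have f: "restrict g I \<in> mod_Hom R ?I E"
    using restrict_mod_Hom[OF g mI] by simp
  have "\<exists>h\<in>mod_Hom R ?S E. compose (carrier ?I) h (restrict (\<lambda>x. x) I) = restrict g I"
    using assms(2) i f mI S.module_axioms unfolding injective_mod_def
    by (elim conjE allE[of _ ?I] allE[of _ ?S] ballE[of _ _ "restrict (\<lambda>x. x) I"]
        ballE[of _ _ "restrict g I"]) (auto simp: inj_on_def mI S.module_axioms)
  then obtain h where h: "linear_map R ?S E h" and hg: "\<And>x. x \<in> I \<Longrightarrow> h x = g x"
    by (fastforce simp: mod_Hom_iff compose_def restrict_def fun_eq_iff split: if_splits)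
  show "\<exists>w\<in>carrier E. \<forall>r\<in>I. g r = r \<odot>\<^bsub>E\<^esub> w"
  proof (intro bexI ballI)
    show "h \<one> \<in> carrier E" using linear_map_closed[OF h] by simp
    fix r assume r: "r \<in> I"
    show "g r = r \<odot>\<^bsub>E\<^esub> h \<one>"
      using linear_map_smult[OF h, of r \<one>] I.Icarr[OF r] hg[OF r] by simp
  qed
qed

text \<open>
  Baer's criterion, in any carrier type. Partial extensions of \<open>f\<close> are represented by their graphs, i.e.\
  by submodules of \<open>B \<times> E\<close> that contain the graph of \<open>f\<close> and meet \<open>0 \<times> E\<close> in \<open>0\<close>; this turns them into a family of sets
  that is closed under unions of chains, so Zorn's lemma gives a maximal one. If \<open>b\<close> is outside its domain \<open>D\<close>, the
  map that sends \<open>r\<close> to the value at \<open>r b\<close>, on the ideal \<open>{r. r b \<in> D}\<close>, is multiplication by some \<open>w\<close>, and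
  sending \<open>b\<close> to \<open>w\<close> enlarges the domain.
\<close>

lemma baer_extend:
  assumes "module R E" "module R B" "baer R E" "submodule A R B"
    and f: "linear_map R (B\<lparr>carrier := A\<rparr>) E f"
  obtains g where "linear_map R B E g" "\<And>x. x \<in> A \<Longrightarrow> g x = f x"
proof -
  interpret E: module R E by fact
  interpret B: module R B by fact
  interpret S: module R "self_module R" by (rule E.R.self_module_module)
  note A = B.submoduleE[OF assms(4)]
  have A0: "\<zero>\<^bsub>B\<^esub> \<in> A"
    using subgroup.one_closed[OF submodule.axioms(1)[OF assms(4)]] by simp
  have mA: "module R (B\<lparr>carrier := A\<rparr>)" by (rule submodule_module[OF assms(2,4)])
  have f0: "f \<zero>\<^bsub>B\<^esub> = \<zero>\<^bsub>E\<^esub>" using linear_map_zero[OF mA assms(1) f] by simp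
  have fc: "f x \<in> carrier E" if "x \<in> A" for x using linear_map_closed[OF f] that by simp
  have fa: "f (x \<oplus>\<^bsub>B\<^esub> y) = f x \<oplus>\<^bsub>E\<^esub> f y" if "x \<in> A" "y \<in> A" for x y
    using linear_map_add[OF f] that by simp
  have fs: "f (a \<odot>\<^bsub>B\<^esub> x) = a \<odot>\<^bsub>E\<^esub> f x" if "a \<in> carrier R" "x \<in> A" for a x
    using linear_map_smult[OF f] that by simp
  define graph where "graph G \<longleftrightarrow> G \<subseteq> carrier B \<times> carrier E \<and> (\<lambda>x. (x, f x)) ` A \<subseteq> G \<and>
     (\<forall>x e y e'. (x, e) \<in> G \<longrightarrow> (y, e') \<in> G \<longrightarrow> (x \<oplus>\<^bsub>B\<^esub> y, e \<oplus>\<^bsub>E\<^esub> e') \<in> G) \<and>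
     (\<forall>a\<in>carrier R. \<forall>x e. (x, e) \<in> G \<longrightarrow> (a \<odot>\<^bsub>B\<^esub> x, a \<odot>\<^bsub>E\<^esub> e) \<in> G) \<and>
     (\<forall>e. (\<zero>\<^bsub>B\<^esub>, e) \<in> G \<longrightarrow> e = \<zero>\<^bsub>E\<^esub>)" for G
  have graphD: "\<And>x e. (x, e) \<in> G \<Longrightarrow> x \<in> carrier B" "\<And>x e. (x, e) \<in> G \<Longrightarrow> e \<in> carrier E"
    "\<And>x. x \<in> A \<Longrightarrow> (x, f x) \<in> G"
    "\<And>x e y e'. (x, e) \<in> G \<Longrightarrow> (y, e') \<in> G \<Longrightarrow> (x \<oplus>\<^bsub>B\<^esub> y, e \<oplus>\<^bsub>E\<^esub> e') \<in> G"
    "\<And>a x e. a \<in> carrier R \<Longrightarrow> (x, e) \<in> G \<Longrightarrow> (a \<odot>\<^bsub>B\<^esub> x, a \<odot>\<^bsub>E\<^esub> e) \<in> G"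
    "\<And>e. (\<zero>\<^bsub>B\<^esub>, e) \<in> G \<Longrightarrow> e = \<zero>\<^bsub>E\<^esub>" if "graph G" for G
    using that unfolding graph_def by blast+
  have functional: "e = e'" if G: "graph G" and xe: "(x, e) \<in> G" "(x, e') \<in> G" for G x e e'
  proof -
    have cl: "x \<in> carrier B" "e \<in> carrier E" "e' \<in> carrier E" using graphD[OF G] xe by blast+
    have "((\<ominus>\<^bsub>R\<^esub> \<one>\<^bsub>R\<^esub>) \<odot>\<^bsub>B\<^esub> x, (\<ominus>\<^bsub>R\<^esub> \<one>\<^bsub>R\<^esub>) \<odot>\<^bsub>E\<^esub> e') \<in> G" using graphD(5)[OF G _ xe(2)] by blast
    then have "(\<ominus>\<^bsub>B\<^esub> x, \<ominus>\<^bsub>E\<^esub> e') \<in> G" using cl by (simp add: B.smult_l_minus E.smult_l_minus)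
    then have "(\<zero>\<^bsub>B\<^esub>, e \<ominus>\<^bsub>E\<^esub> e') \<in> G"
      using graphD(4)[OF G xe(1)] cl by (metis B.r_neg a_minus_def)
    then show ?thesis using graphD(6)[OF G] minus_eq_zero_iff[OF assms(1)] cl by blast
  qed
  have "\<exists>G\<in>{G. graph G}. \<forall>K\<in>{G. graph G}. G \<subseteq> K \<longrightarrow> K = G"
  proof (rule subset_Zorn_nonempty)
    have "graph ((\<lambda>x. (x, f x)) ` A)"
      unfolding graph_def using A fc fa fs f0 A0 by auto
    then show "{G. graph G} \<noteq> {}" by blast
  next
    fix \<C> assume ne: "\<C> \<noteq> {}" and ch: "subset.chain ({G. graph G}) \<C>"
    have gr: "graph G" if "G \<in> \<C>" for G using ch that by (auto simp: subset.chain_def)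
    have two: "\<exists>G\<in>\<C>. p \<in> G \<and> q \<in> G" if "p \<in> \<Union>\<C>" "q \<in> \<Union>\<C>" for p q
    proof -
      obtain G H where GH: "G \<in> \<C>" "H \<in> \<C>" "p \<in> G" "q \<in> H" using \<open>p \<in> \<Union>\<C>\<close> \<open>q \<in> \<Union>\<C>\<close> by blast
      then have "G \<subseteq> H \<or> H \<subseteq> G" using ch unfolding subset.chain_def by blast
      then show ?thesis using GH by blast
    qed
    have "graph (\<Union>\<C>)"
      unfolding graph_def
    proof (intro conjI allI ballI impI)
      show "\<Union>\<C> \<subseteq> carrier B \<times> carrier E" using gr unfolding graph_def by blast
      show "(\<lambda>x. (x, f x)) ` A \<subseteq> \<Union>\<C>" using gr ne unfolding graph_def by blast
      show "(x \<oplus>\<^bsub>B\<^esub> y, e \<oplus>\<^bsub>E\<^esub> e') \<in> \<Union>\<C>" if "(x, e) \<in> \<Union>\<C>" "(y, e') \<in> \<Union>\<C>" for x e y e'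
        using two[OF that] graphD(4)[OF gr] by blast
      show "(a \<odot>\<^bsub>B\<^esub> x, a \<odot>\<^bsub>E\<^esub> e) \<in> \<Union>\<C>" if "a \<in> carrier R" "(x, e) \<in> \<Union>\<C>" for a x e
        using that graphD(5)[OF gr] by blast
      show "e = \<zero>\<^bsub>E\<^esub>" if "(\<zero>\<^bsub>B\<^esub>, e) \<in> \<Union>\<C>" for e
        using that graphD(6)[OF gr] by blast
    qed
    then show "\<Union>\<C> \<in> {G. graph G}" by simp
  qed
  then obtain G where G: "graph G" and max: "\<And>K. graph K \<Longrightarrow> G \<subseteq> K \<Longrightarrow> K = G" by blast
  note D = graphD[OF G]
  have zero: "(\<zero>\<^bsub>B\<^esub>, \<zero>\<^bsub>E\<^esub>) \<in> G" using D(3)[OF A0] f0 by simp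
  have total: "\<exists>e. (b, e) \<in> G" if b: "b \<in> carrier B" for b
  proof -
    define I where "I = {r \<in> carrier R. \<exists>e. (r \<odot>\<^bsub>B\<^esub> b, e) \<in> G}"
    define \<phi> where "\<phi> r = (THE e. (r \<odot>\<^bsub>B\<^esub> b, e) \<in> G)" for r
    have \<phi>: "\<phi> r = e" if "(r \<odot>\<^bsub>B\<^esub> b, e) \<in> G" for r e
      unfolding \<phi>_def using that functional[OF G] by blast
    have \<phi>G: "(r \<odot>\<^bsub>B\<^esub> b, \<phi> r) \<in> G" if "r \<in> I" for r using that \<phi> unfolding I_def by blast
    have Ia: "((r \<oplus>\<^bsub>R\<^esub> s) \<odot>\<^bsub>B\<^esub> b, \<phi> r \<oplus>\<^bsub>E\<^esub> \<phi> s) \<in> G" if "r \<in> I" "s \<in> I" for r s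
      using D(4)[OF \<phi>G \<phi>G] that b by (simp add: I_def B.smult_l_distr)
    have Is: "((a \<otimes>\<^bsub>R\<^esub> r) \<odot>\<^bsub>B\<^esub> b, a \<odot>\<^bsub>E\<^esub> \<phi> r) \<in> G" if "r \<in> I" "a \<in> carrier R" for r a
      using D(5)[OF _ \<phi>G] that b by (simp add: I_def B.smult_assoc1)
    have "submodule I R (self_module R)"
    proof (rule S.submoduleI)
      show "I \<subseteq> carrier (self_module R)" by (auto simp: I_def)
      show "\<zero>\<^bsub>self_module R\<^esub> \<in> I" using zero b by (auto simp: I_def)
      show "a \<oplus>\<^bsub>self_module R\<^esub> a' \<in> I" if "a \<in> I" "a' \<in> I" for a a'
        using Ia[OF that] that by (auto simp: I_def)
      show sm: "a \<odot>\<^bsub>self_module R\<^esub> r \<in> I" if "a \<in> carrier R" "r \<in> I" for a r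
        using Is[OF that(2,1)] that by (auto simp: I_def)
      show "\<ominus>\<^bsub>self_module R\<^esub> a \<in> I" if "a \<in> I" for a
        using sm[of "\<ominus>\<^bsub>R\<^esub> \<one>\<^bsub>R\<^esub>" a] S.smult_l_minus[of "\<one>\<^bsub>R\<^esub>" a] S.a_inv_closed[of a] that
        by (simp add: I_def)
    qed
    then have "ideal I R" by (simp add: E.R.ideal_iff_submodule)
    moreover have "linear_map R ((self_module R)\<lparr>carrier := I\<rparr>) E \<phi>"
      by (rule linear_mapI) (use \<phi>G D(2) \<phi>[OF Ia] \<phi>[OF Is] in auto)
    ultimately obtain w where w: "w \<in> carrier E" "\<And>r. r \<in> I \<Longrightarrow> \<phi> r = r \<odot>\<^bsub>E\<^esub> w"
      using assms(3) unfolding baer_def by blast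
    define G' where "G' = {(x \<oplus>\<^bsub>B\<^esub> r \<odot>\<^bsub>B\<^esub> b, e \<oplus>\<^bsub>E\<^esub> r \<odot>\<^bsub>E\<^esub> w) | x e r. (x, e) \<in> G \<and> r \<in> carrier R}"
    have G'I: "(x \<oplus>\<^bsub>B\<^esub> r \<odot>\<^bsub>B\<^esub> b, e \<oplus>\<^bsub>E\<^esub> r \<odot>\<^bsub>E\<^esub> w) \<in> G'" if "(x, e) \<in> G" "r \<in> carrier R" for x e r
      using that unfolding G'_def by blast
    have sub: "G \<subseteq> G'"
    proof safe
      fix x e assume xe: "(x, e) \<in> G"
      then show "(x, e) \<in> G'" using G'I[OF xe, of "\<zero>\<^bsub>R\<^esub>"] D(1,2)[OF xe] b w by simp
    qed
    have "graph G'"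
      unfolding graph_def
    proof (intro conjI allI ballI impI)
      show "G' \<subseteq> carrier B \<times> carrier E" unfolding G'_def using D(1,2) b w by auto
      show "(\<lambda>x. (x, f x)) ` A \<subseteq> G'" using D(3) sub by blast
      fix x e y e' assume "(x, e) \<in> G'" "(y, e') \<in> G'"
      then obtain x1 e1 r1 x2 e2 r2 where *:
        "(x1, e1) \<in> G" "r1 \<in> carrier R" "x = x1 \<oplus>\<^bsub>B\<^esub> r1 \<odot>\<^bsub>B\<^esub> b" "e = e1 \<oplus>\<^bsub>E\<^esub> r1 \<odot>\<^bsub>E\<^esub> w"
        "(x2, e2) \<in> G" "r2 \<in> carrier R" "y = x2 \<oplus>\<^bsub>B\<^esub> r2 \<odot>\<^bsub>B\<^esub> b" "e' = e2 \<oplus>\<^bsub>E\<^esub> r2 \<odot>\<^bsub>E\<^esub> w"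
        unfolding G'_def by blast
      have "x \<oplus>\<^bsub>B\<^esub> y = (x1 \<oplus>\<^bsub>B\<^esub> x2) \<oplus>\<^bsub>B\<^esub> (r1 \<oplus>\<^bsub>R\<^esub> r2) \<odot>\<^bsub>B\<^esub> b"
        "e \<oplus>\<^bsub>E\<^esub> e' = (e1 \<oplus>\<^bsub>E\<^esub> e2) \<oplus>\<^bsub>E\<^esub> (r1 \<oplus>\<^bsub>R\<^esub> r2) \<odot>\<^bsub>E\<^esub> w"
        using * D(1,2)[OF *(1)] D(1,2)[OF *(5)] b w
        by (simp_all add: B.smult_l_distr E.smult_l_distr B.a_ac E.a_ac)
      then show "(x \<oplus>\<^bsub>B\<^esub> y, e \<oplus>\<^bsub>E\<^esub> e') \<in> G'"
        using G'I[OF D(4)[OF *(1,5)], of "r1 \<oplus>\<^bsub>R\<^esub> r2"] *(2,6) by simp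
    next
      fix a x e assume a: "a \<in> carrier R" and "(x, e) \<in> G'"
      then obtain x1 e1 r1 where *:
        "(x1, e1) \<in> G" "r1 \<in> carrier R" "x = x1 \<oplus>\<^bsub>B\<^esub> r1 \<odot>\<^bsub>B\<^esub> b" "e = e1 \<oplus>\<^bsub>E\<^esub> r1 \<odot>\<^bsub>E\<^esub> w"
        unfolding G'_def by blast
      have "a \<odot>\<^bsub>B\<^esub> x = a \<odot>\<^bsub>B\<^esub> x1 \<oplus>\<^bsub>B\<^esub> (a \<otimes>\<^bsub>R\<^esub> r1) \<odot>\<^bsub>B\<^esub> b"
        "a \<odot>\<^bsub>E\<^esub> e = a \<odot>\<^bsub>E\<^esub> e1 \<oplus>\<^bsub>E\<^esub> (a \<otimes>\<^bsub>R\<^esub> r1) \<odot>\<^bsub>E\<^esub> w"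
        using * D(1,2)[OF *(1)] b w a
        by (simp_all add: B.smult_r_distr E.smult_r_distr B.smult_assoc1 E.smult_assoc1)
      then show "(a \<odot>\<^bsub>B\<^esub> x, a \<odot>\<^bsub>E\<^esub> e) \<in> G'"
        using G'I[OF D(5)[OF a *(1)], of "a \<otimes>\<^bsub>R\<^esub> r1"] *(2) a by simp
    next
      fix e assume "(\<zero>\<^bsub>B\<^esub>, e) \<in> G'"
      then obtain x1 e1 r1 where *:
        "(x1, e1) \<in> G" "r1 \<in> carrier R" "\<zero>\<^bsub>B\<^esub> = x1 \<oplus>\<^bsub>B\<^esub> r1 \<odot>\<^bsub>B\<^esub> b" "e = e1 \<oplus>\<^bsub>E\<^esub> r1 \<odot>\<^bsub>E\<^esub> w"
        unfolding G'_def by blast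
      note cl = D(1,2)[OF *(1)]
      have r: "r1 \<odot>\<^bsub>B\<^esub> b = \<ominus>\<^bsub>B\<^esub> x1"
        using *(2,3) cl b by (metis B.a_comm B.minus_equality B.smult_closed)
      have "((\<ominus>\<^bsub>R\<^esub> \<one>\<^bsub>R\<^esub>) \<odot>\<^bsub>B\<^esub> x1, (\<ominus>\<^bsub>R\<^esub> \<one>\<^bsub>R\<^esub>) \<odot>\<^bsub>E\<^esub> e1) \<in> G" using D(5)[OF _ *(1)] by blast
      then have m: "(r1 \<odot>\<^bsub>B\<^esub> b, \<ominus>\<^bsub>E\<^esub> e1) \<in> G"
        using cl by (simp add: B.smult_l_minus E.smult_l_minus r)
      then have "r1 \<in> I" using *(2) unfolding I_def by blast
      then have "r1 \<odot>\<^bsub>E\<^esub> w = \<ominus>\<^bsub>E\<^esub> e1" using w(2) \<phi>[OF m] by metis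
      then show "e = \<zero>\<^bsub>E\<^esub>" using *(4) cl by (simp add: E.r_neg)
    qed
    then have "G' = G" using max sub by blast
    moreover have "(b, w) \<in> G'" using G'I[OF zero, of "\<one>\<^bsub>R\<^esub>"] b w by simp
    ultimately show ?thesis by blast
  qed
  define g where "g x = (THE e. (x, e) \<in> G)" for x
  have g: "g x = e" if "(x, e) \<in> G" for x e
    unfolding g_def using that functional[OF G] by blast
  have gG: "(x, g x) \<in> G" if "x \<in> carrier B" for x using total[OF that] g by metis
  have "linear_map R B E g"
    proof (rule linear_mapI)
    show "g x \<in> carrier E" if "x \<in> carrier B" for x using D(2) gG[OF that] by blast
    show "g (x \<oplus>\<^bsub>B\<^esub> y) = g x \<oplus>\<^bsub>E\<^esub> g y" if "x \<in> carrier B" "y \<in> carrier B" for x y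
      by (rule g[OF D(4)[OF gG gG]]) (use that in auto)
    show "g (a \<odot>\<^bsub>B\<^esub> x) = a \<odot>\<^bsub>E\<^esub> g x" if "a \<in> carrier R" "x \<in> carrier B" for a x
      by (rule g[OF D(5)[OF _ gG]]) (use that in auto)
  qed
  moreover have "g x = f x" if "x \<in> A" for x using g D(3) that by blast
  ultimately show ?thesis using that by blast
qed

lemma baer_extend_mono:
  assumes "module R E" "module R A" "module R B" "baer R E"
    and i: "linear_map R A B i" "inj_on i (carrier A)" and f: "linear_map R A E f"
  obtains g where "linear_map R B E g" "\<And>x. x \<in> carrier A \<Longrightarrow> g (i x) = f x"
proof -
  interpret A: module R A by fact
  interpret B: module R B by fact
  let ?J = "B\<lparr>carrier := i ` carrier A\<rparr>"
  have J: "submodule (i ` carrier A) R B" by (rule image_submodule[OF assms(2,3) i(1)])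
  have mJ: "module R ?J" by (rule submodule_module[OF assms(3) J])
  have iJ: "linear_map R A ?J i" by (rule linear_map_codomain[OF i(1)]) simp
  have "f x = \<zero>\<^bsub>E\<^esub>" if "x \<in> carrier A" "i x = \<zero>\<^bsub>?J\<^esub>" for x
  proof -
    have "x = \<zero>\<^bsub>A\<^esub>"
      using that linear_map_zero[OF assms(2,3) i(1)] inj_onD[OF i(2), of x "\<zero>\<^bsub>A\<^esub>"] by simp
    then show ?thesis using linear_map_zero[OF assms(2,1) f] by simp
  qed
  then obtain d where d: "linear_map R ?J E d" "\<And>x. x \<in> carrier A \<Longrightarrow> d (i x) = f x"
    using factor_through_surjection[OF assms(2) mJ assms(1) iJ _ f] by auto
  obtain g where "linear_map R B E g" "\<And>x. x \<in> i ` carrier A \<Longrightarrow> g x = d x"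
    using baer_extend[OF assms(1,3,4) J d(1)] by blast
  with d(2) show ?thesis using that by auto
qed

text \<open>
  The annihilator condition makes \<open>r x \<mapsto> r y\<close> well defined on the cyclic submodule generated by \<open>x\<close>,
  and injectivity extends this map.
\<close>

lemma baer_extend_cyclic:
  assumes "module R E" "module R M" "baer R E" "x \<in> carrier M" "y \<in> carrier E"
    and ann: "\<And>r. r \<in> carrier R \<Longrightarrow> r \<odot>\<^bsub>M\<^esub> x = \<zero>\<^bsub>M\<^esub> \<Longrightarrow> r \<odot>\<^bsub>E\<^esub> y = \<zero>\<^bsub>E\<^esub>"
  obtains g where "linear_map R M E g" "g x = y"
proof -
  interpret E: module R E by fact
  interpret M: module R M by fact
  let ?S = "self_module R"
  have mS: "module R ?S" by (rule E.R.self_module_module)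
  have px: "linear_map R ?S M (\<lambda>r. r \<odot>\<^bsub>M\<^esub> x)"
    by (rule E.R.linear_map_cyclic[OF assms(2,4)])
  have py: "linear_map R ?S E (\<lambda>r. r \<odot>\<^bsub>E\<^esub> y)"
    by (rule E.R.linear_map_cyclic[OF assms(1,5)])
  let ?J = "M\<lparr>carrier := (\<lambda>r. r \<odot>\<^bsub>M\<^esub> x) ` carrier R\<rparr>"
  have J: "submodule ((\<lambda>r. r \<odot>\<^bsub>M\<^esub> x) ` carrier R) R M" using image_submodule[OF mS assms(2) px] by simp
  have mJ: "module R ?J" by (rule submodule_module[OF assms(2) J])
  have pJ: "linear_map R ?S ?J (\<lambda>r. r \<odot>\<^bsub>M\<^esub> x)" by (rule linear_map_codomain[OF px]) simp
  obtain d where d: "linear_map R ?J E d" "\<And>r. r \<in> carrier R \<Longrightarrow> d (r \<odot>\<^bsub>M\<^esub> x) = r \<odot>\<^bsub>E\<^esub> y"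
    using factor_through_surjection[OF mS mJ assms(1) pJ _ py] ann by auto
  obtain g where g: "linear_map R M E g" "\<And>z. z \<in> (\<lambda>r. r \<odot>\<^bsub>M\<^esub> x) ` carrier R \<Longrightarrow> g z = d z"
    using baer_extend[OF assms(1,2,3) J d(1)] by blast
  have "g (\<one>\<^bsub>R\<^esub> \<odot>\<^bsub>M\<^esub> x) = \<one>\<^bsub>R\<^esub> \<odot>\<^bsub>E\<^esub> y" using g(2) d(2) by auto
  then show ?thesis using that g(1) assms(4,5) by simp
qed

section \<open>Local Artinian rings\<close>

text \<open>
  The consequences of being local and Artinian that enter the proof: the non-units form
  an ideal \<open>m\<close>, and its elements are nilpotent.
\<close>

locale local_artinian = cring R + noetherian_ring R for R (structure) +
  fixes m
  assumes m_ideal: "ideal m R" and one_not_in_m: "\<one> \<notin> m"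
    and invertible: "r \<in> carrier R \<Longrightarrow> r \<notin> m \<Longrightarrow> \<exists>s\<in>carrier R. s \<otimes> r = \<one>"
    and nilpotent: "r \<in> m \<Longrightarrow> \<exists>k::nat. r [^] k = \<zero>"

text \<open>
  An element outside \<open>m\<close> is a unit because a proper ideal containing it would lie in a second maximal ideal.
  An element \<open>r\<close> of \<open>m\<close> is nilpotent because the chain of the ideals \<open>(r\<^sup>n)\<close> becomes stationary, which gives
  \<open>r\<^sup>k = s r\<^sup>k\<^sup>+\<^sup>1\<close>, and \<open>\<one> - s r\<close> is a unit.
\<close>

lemma local_artinianI:
  fixes R (structure)
  assumes "local_ring R" "noetherian_ring R" "artinian_ring R"
  obtains m where "local_artinian R m"
proof -
  interpret cring R using assms(1) by (simp add: local_ring_def)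
  interpret noetherian_ring R by fact
  obtain m where m: "maximalideal m R" and uniq: "\<And>n. maximalideal n R \<Longrightarrow> n = m"
    using assms(1) unfolding local_ring_def by blast
  interpret m: maximalideal m R by (rule m)
  have one: "\<one> \<notin> m" using m.I_notcarr m.one_imp_carrier by blast
  have inv: "\<exists>s\<in>carrier R. s \<otimes> r = \<one>" if r: "r \<in> carrier R" "r \<notin> m" for r
  proof (rule ccontr)
    assume no: "\<not> ?thesis"
    let ?P = "{J. ideal J R \<and> r \<in> J \<and> \<one> \<notin> J}"
    have "\<exists>M\<in>?P. \<forall>J\<in>?P. M \<subseteq> J \<longrightarrow> J = M"
    proof (rule subset_Zorn_nonempty)
      have "\<one> \<notin> PIdl r" using no unfolding cgenideal_def by auto
      then show "?P \<noteq> {}" using cgenideal_ideal[OF r(1)] cgenideal_self[OF r(1)] by blast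
      fix \<C> assume c: "\<C> \<noteq> {}" "subset.chain ?P \<C>"
      then have "subset.chain {I. ideal I R} \<C>" unfolding subset.chain_def by blast
      then have "\<Union>\<C> \<in> \<C>" by (rule ideal_chain_is_trivial[OF c(1)])
      then show "\<Union>\<C> \<in> ?P" using c(2) unfolding subset.chain_def by blast
    qed
    then obtain M where M: "ideal M R" "r \<in> M" "\<one> \<notin> M"
      and max: "\<And>J. ideal J R \<Longrightarrow> r \<in> J \<Longrightarrow> \<one> \<notin> J \<Longrightarrow> M \<subseteq> J \<Longrightarrow> J = M" by blast
    have "maximalideal M R"
    proof (rule maximalidealI[OF M(1)])
      show "carrier R \<noteq> M" using M(3) by blast
      fix J assume J: "ideal J R" "M \<subseteq> J" "J \<subseteq> carrier R"
      show "J = M \<or> J = carrier R"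
        using max[OF J(1)] M(2) J(2) ideal.one_imp_carrier[OF J(1)] by blast
    qed
    then show False using uniq M(2) r(2) by blast
  qed
  have nil: "\<exists>k::nat. r [^] k = \<zero>" if r: "r \<in> m" for r
  proof -
    have rc: "r \<in> carrier R" using r m.Icarr by blast
    have "PIdl (r [^] Suc n) \<subseteq> PIdl (r [^] n)" for n
    proof
      fix x assume "x \<in> PIdl (r [^] Suc n)"
      then obtain s where s: "s \<in> carrier R" "x = s \<otimes> r [^] Suc n" unfolding cgenideal_def by blast
      then have "x = (s \<otimes> r) \<otimes> r [^] n" using rc by (simp add: m_ac)
      then show "x \<in> PIdl (r [^] n)" using s rc unfolding cgenideal_def by blast
    qed
    then have "\<forall>n::nat. ideal (PIdl (r [^] n)) R \<and> PIdl (r [^] Suc n) \<subseteq> PIdl (r [^] n)"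
      using cgenideal_ideal[OF nat_pow_closed[OF rc]] by blast
    then have "\<exists>k::nat. \<forall>n\<ge>k. PIdl (r [^] n) = PIdl (r [^] k)"
      by (rule artinian_ring_def[THEN iffD1, OF assms(3), THEN conjunct2,
          THEN spec[of _ "\<lambda>n. PIdl (r [^] n)"], THEN mp])
    then obtain k :: nat where k0: "\<forall>n\<ge>k. PIdl (r [^] n) = PIdl (r [^] k)" ..
    have k: "PIdl (r [^] Suc k) = PIdl (r [^] k)"
      using spec[OF k0, of "Suc k"] by (simp del: nat_pow_Suc)
    have "r [^] k \<in> PIdl (r [^] Suc k)"
      using cgenideal_self[OF nat_pow_closed[OF rc], of k] by (simp only: k)
    then obtain s where s: "s \<in> carrier R" "r [^] k = s \<otimes> r [^] Suc k" unfolding cgenideal_def by blast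
    have "\<one> \<ominus> s \<otimes> r \<notin> m"
    proof
      assume "\<one> \<ominus> s \<otimes> r \<in> m"
      then have "(\<one> \<ominus> s \<otimes> r) \<oplus> s \<otimes> r \<in> m" using m.I_l_closed[OF r s(1)] by (rule m.a_closed)
      moreover have "(\<one> \<ominus> s \<otimes> r) \<oplus> s \<otimes> r = \<one>"
        using s(1) rc by (simp add: a_minus_def a_assoc l_neg)
      ultimately show False using one by simp
    qed
    moreover have cc: "\<one> \<ominus> s \<otimes> r \<in> carrier R" using s(1) rc by simp
    ultimately obtain t where t: "t \<in> carrier R" "t \<otimes> (\<one> \<ominus> s \<otimes> r) = \<one>" using inv by blast
    have "(\<one> \<ominus> s \<otimes> r) \<otimes> r [^] k = r [^] k \<ominus> (s \<otimes> r) \<otimes> r [^] k"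
      using s(1) rc by (simp add: a_minus_def l_distr l_minus)
    also have "(s \<otimes> r) \<otimes> r [^] k = r [^] k"
      using s(1) s(2)[symmetric] rc m_assoc[of s r "r [^] k"] m_comm[of r "r [^] k"] by simp
    also have "r [^] k \<ominus> r [^] k = \<zero>" using rc by (simp add: a_minus_def r_neg)
    finally have z: "(\<one> \<ominus> s \<otimes> r) \<otimes> r [^] k = \<zero>" .
    have "r [^] k = (t \<otimes> (\<one> \<ominus> s \<otimes> r)) \<otimes> r [^] k" unfolding t(2) using rc by simp
    also have "\<dots> = t \<otimes> ((\<one> \<ominus> s \<otimes> r) \<otimes> r [^] k)" by (rule m_assoc) (use t cc rc in auto)
    also have "\<dots> = \<zero>" unfolding z using t by simp
    finally show ?thesis by blast
  qed
  have "local_artinian R m"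
    by (intro local_artinian.intro local_artinian_axioms.intro)
      (rule cring_axioms noetherian_ring_axioms m.ideal_axioms one inv nil; assumption?)+
  then show ?thesis using that by blast
qed

context local_artinian
begin

lemma m_subset: "m \<subseteq> carrier R"
  using ideal.Icarr[OF m_ideal] by blast

lemma annihilator_subset_m:
  fixes M :: "('a, 'y) module"
  assumes "module R M" "x \<in> carrier M" "x \<noteq> \<zero>\<^bsub>M\<^esub>" "r \<in> carrier R" "r \<odot>\<^bsub>M\<^esub> x = \<zero>\<^bsub>M\<^esub>"
  shows "r \<in> m"
proof (rule ccontr)
  interpret M: module R M by fact
  assume "r \<notin> m"
  then obtain s where s: "s \<in> carrier R" "s \<otimes> r = \<one>" using invertible assms(4) by blast
  have "x = (s \<otimes> r) \<odot>\<^bsub>M\<^esub> x" using s assms(2) by simp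
  also have "\<dots> = \<zero>\<^bsub>M\<^esub>" using s(1) assms by (simp add: M.smult_assoc1 del: s)
  finally show False using assms(3) by blast
qed

text \<open>
  The socle of \<open>Y/N\<close> is nonzero, even if \<open>Y/N\<close> is not finitely generated. The ideal \<open>m\<close> is generated by finitely many
  nilpotent elements. Treat them one at a time: if \<open>r\<^sup>k y\<close> is the last power multiple outside \<open>N\<close>, then \<open>r\<close>
  carries it into \<open>N\<close>, and so do the generators treated before.
\<close>

lemma socle_element:
  fixes Y :: "('a, 'y) module"
  assumes "module R Y" "submodule N R Y" "N \<noteq> carrier Y"
  obtains y where "y \<in> carrier Y" "y \<notin> N" "\<And>r. r \<in> m \<Longrightarrow> r \<odot>\<^bsub>Y\<^esub> y \<in> N"
proof -
  interpret Y: module R Y by fact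
  note N = Y.submoduleE[OF assms(2)]
  have N0: "\<zero>\<^bsub>Y\<^esub> \<in> N" using subgroup.one_closed[OF submodule.axioms(1)[OF assms(2)]] by simp
  obtain S where S: "S \<subseteq> carrier R" "finite S" "m = Idl S" using finetely_gen[OF m_ideal] by blast
  have Sm: "S \<subseteq> m" using genideal_self[OF S(1)] S(3) by simp
  have "\<exists>y\<in>carrier Y - N. \<forall>s\<in>S. s \<odot>\<^bsub>Y\<^esub> y \<in> N"
    using S(2) Sm
  proof (induction S)
    case empty
    then show ?case using N(1) assms(3) by auto
  next
    case (insert r S)
    then obtain y where y: "y \<in> carrier Y" "y \<notin> N" "\<And>s. s \<in> S \<Longrightarrow> s \<odot>\<^bsub>Y\<^esub> y \<in> N" by auto
    have rc: "r \<in> carrier R" using insert.prems m_subset by auto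
    have sc: "s \<in> carrier R" if "s \<in> S" for s using insert.prems m_subset that by auto
    let ?Q = "\<lambda>k::nat. r [^] k \<odot>\<^bsub>Y\<^esub> y \<in> N"
    obtain k0 :: nat where "r [^] k0 = \<zero>" using nilpotent insert.prems by auto
    then have "?Q k0" using N0 y(1) by simp
    moreover have "\<not> ?Q 0" using y by simp
    \<comment> \<open>The last power of \<open>r\<close> that leaves \<open>y\<close> outside \<open>N\<close>.\<close>
    ultimately obtain k where k: "\<not> ?Q k" "?Q (Suc k)" using ex_least_nat_less[of ?Q k0] by auto
    let ?z = "r [^] k \<odot>\<^bsub>Y\<^esub> y"
    have "r \<odot>\<^bsub>Y\<^esub> ?z \<in> N"
      using k(2) rc y(1) by (simp add: Y.smult_assoc1[symmetric] m_comm)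
    moreover have "s \<odot>\<^bsub>Y\<^esub> ?z \<in> N" if "s \<in> S" for s
    proof -
      have "s \<odot>\<^bsub>Y\<^esub> ?z = r [^] k \<odot>\<^bsub>Y\<^esub> (s \<odot>\<^bsub>Y\<^esub> y)"
        using rc sc[OF that] y(1) by (simp add: Y.smult_assoc1[symmetric] m_comm)
      then show ?thesis using N(4) y(3)[OF that] rc by simp
    qed
    ultimately show ?case using k(1) rc y(1) by (intro bexI[of _ ?z]) auto
  qed
  then obtain y where y: "y \<in> carrier Y" "y \<notin> N" "\<And>s. s \<in> S \<Longrightarrow> s \<odot>\<^bsub>Y\<^esub> y \<in> N" by blast
  have "ideal {r \<in> carrier R. r \<odot>\<^bsub>Y\<^esub> y \<in> N} R"
    using preimage_submodule[OF self_module_module assms(1) linear_map_cyclic[OF assms(1) y(1)] assms(2)]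
    by (simp add: ideal_iff_submodule)
  then have "m \<subseteq> {r \<in> carrier R. r \<odot>\<^bsub>Y\<^esub> y \<in> N}"
    unfolding S(3) by (rule genideal_minimal) (use S(1) y(3) in auto)
  then show ?thesis using that y(1,2) by blast
qed

end

section \<open>Projective and injective modules over a self-injective local ring\<close>

locale local_self_injective = local_artinian +
  assumes self_injective: "baer R (self_module R)"
begin

text \<open>
  The socle of a self-injective local ring is simple, and every nonzero ideal contains it: given a
  nonzero \<open>r\<close>, choose a nonzero socle element \<open>a r\<close> of the ideal \<open>(r)\<close>. Its annihilator is contained in \<open>m\<close>, so some map
  \<open>R \<rightarrow> R\<close> sends \<open>a r\<close> to \<open>\<sigma>\<close>, and this map is a multiplication.
\<close>

lemma socle_generator:
  obtains \<sigma> where "\<sigma> \<in> carrier R" "\<sigma> \<noteq> \<zero>" "\<And>r. r \<in> m \<Longrightarrow> r \<otimes> \<sigma> = \<zero>"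
    "\<And>r. r \<in> carrier R \<Longrightarrow> r \<noteq> \<zero> \<Longrightarrow> \<exists>t\<in>carrier R. t \<otimes> r = \<sigma>"
proof -
  let ?S = "self_module R"
  have mS: "module R ?S" by (rule self_module_module)
  interpret S: module R ?S by (rule mS)
  have nz: "\<one> \<noteq> \<zero>" using one_not_in_m additive_subgroup.zero_closed[OF ideal.axioms(1)[OF m_ideal]] by auto
  have z: "submodule {\<zero>} R ?S"
    using ideal_iff_submodule zeroideal by blast
  obtain \<sigma> where \<sigma>: "\<sigma> \<in> carrier R" "\<sigma> \<noteq> \<zero>" "\<And>r. r \<in> m \<Longrightarrow> r \<otimes> \<sigma> = \<zero>"
  proof -
    have "{\<zero>} \<noteq> carrier ?S" using nz one_closed by auto
    then show thesis
    proof (rule socle_element[OF mS z])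
      fix y assume y: "y \<in> carrier ?S" "y \<notin> {\<zero>}" "\<And>r. r \<in> m \<Longrightarrow> r \<odot>\<^bsub>?S\<^esub> y \<in> {\<zero>}"
      show thesis by (rule that[of y]) (use y in simp_all)
    qed
  qed
  have "\<exists>t\<in>carrier R. t \<otimes> r = \<sigma>" if r: "r \<in> carrier R" "r \<noteq> \<zero>" for r
  proof -
    let ?T = "{a \<in> carrier R. a \<otimes> r \<in> {\<zero>}}"
    have T: "submodule ?T R ?S"
      using preimage_submodule[OF mS mS linear_map_cyclic[OF mS] z, of r] r by simp
    have "\<one> \<notin> ?T" using r by simp
    then have T': "?T \<noteq> carrier ?S" using one_closed unfolding self_module_simps by blast
    obtain a where a: "a \<in> carrier R" "a \<otimes> r \<noteq> \<zero>" "\<And>s. s \<in> m \<Longrightarrow> (s \<otimes> a) \<otimes> r = \<zero>"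
    proof (rule socle_element[OF mS T T'])
      fix a assume a: "a \<in> carrier ?S" "a \<notin> ?T" "\<And>s. s \<in> m \<Longrightarrow> s \<odot>\<^bsub>?S\<^esub> a \<in> ?T"
      show thesis by (rule that[of a]) (use a in simp_all)
    qed
    have ar: "a \<otimes> r \<in> carrier ?S" using a r by simp
    have "s \<otimes> \<sigma> = \<zero>" if "s \<in> carrier R" "s \<otimes> (a \<otimes> r) = \<zero>" for s
      using annihilator_subset_m[OF mS ar] a that \<sigma>(3) by simp
    then obtain g where g: "linear_map R ?S ?S g" "g (a \<otimes> r) = \<sigma>"
      using baer_extend_cyclic[OF mS mS self_injective ar, of \<sigma>] \<sigma>(1) by auto
    have "g (a \<otimes> r) = (a \<otimes> r) \<otimes> g \<one>"
      using linear_map_smult[OF g(1), of "a \<otimes> r" \<one>] ar by simp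
    moreover have g1: "g \<one> \<in> carrier R" using linear_map_closed[OF g(1)] by simp
    ultimately have "(g \<one> \<otimes> a) \<otimes> r = \<sigma>" using g(2) a(1) r(1) by (simp add: m_ac)
    then show ?thesis using g1 a(1) by blast
  qed
  then show ?thesis using that \<sigma> by blast
qed

text \<open>
  A map from a finitely generated ideal to a free module meets only finitely many coordinates, and
  in each of them it is multiplication by an element of \<open>R\<close>. These elements form a vector of finite support.
\<close>

lemma free_mod_baer: "baer R (free_mod R B)"
  unfolding baer_def
proof (intro allI impI, elim conjE)
  let ?S = "self_module R" and ?F = "free_mod R B"
  have mS: "module R ?S" by (rule self_module_module)
  interpret S: module R ?S by (rule mS)
  fix I g assume I: "ideal I R" and g: "linear_map R (?S\<lparr>carrier := I\<rparr>) ?F g"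
  interpret I: ideal I R by (rule I)
  have sI: "submodule I R ?S" using I ideal_iff_submodule by blast
  have mI: "module R (?S\<lparr>carrier := I\<rparr>)" by (rule submodule_module[OF mS sI])
  have gc: "g r \<in> carrier ?F" if "r \<in> I" for r using linear_map_closed[OF g] that by simp
  have coord: "linear_map R (?S\<lparr>carrier := I\<rparr>) ?S (\<lambda>r. g r b)" for b
  proof (rule linear_mapI)
    show "g r b \<in> carrier ?S" if "r \<in> carrier (?S\<lparr>carrier := I\<rparr>)" for r
      using free_mod_closed[OF gc] that by simp
  qed (use linear_map_add[OF g] linear_map_smult[OF g] in auto)
  obtain A where A: "A \<subseteq> carrier R" "finite A" "I = Idl A" using finetely_gen[OF I] by blast
  have AI: "A \<subseteq> I" using genideal_self[OF A(1)] A(3) by simp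
  define T where "T = (\<Union>a\<in>A. {b. g a b \<noteq> \<zero>})"
  have finT: "finite T" unfolding T_def using A(2) gc AI by (auto simp: free_mod_carrier)
  have TB: "T \<subseteq> B" unfolding T_def using gc AI by (auto simp: free_mod_carrier subset_iff)
  have off: "g r b = \<zero>" if "b \<notin> T" "r \<in> I" for r b
  proof -
    have "submodule {r \<in> I. g r b = \<zero>} R ?S"
    proof (rule S.submoduleI)
      note c = coord[of b]
      show "{r \<in> I. g r b = \<zero>} \<subseteq> carrier ?S" using I.Icarr by auto
      show "\<zero>\<^bsub>?S\<^esub> \<in> {r \<in> I. g r b = \<zero>}" using linear_map_zero[OF mI mS c] I.zero_closed by simp
      show "a \<oplus>\<^bsub>?S\<^esub> a' \<in> {r \<in> I. g r b = \<zero>}"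
        if "a \<in> {r \<in> I. g r b = \<zero>}" "a' \<in> {r \<in> I. g r b = \<zero>}" for a a'
        using that linear_map_add[OF c, of a a'] I.a_closed by simp
      show sm: "a \<odot>\<^bsub>?S\<^esub> r \<in> {r \<in> I. g r b = \<zero>}" if "a \<in> carrier R" "r \<in> {r \<in> I. g r b = \<zero>}" for a r
        using that linear_map_smult[OF c, of a r] I.I_l_closed by simp
      show "\<ominus>\<^bsub>?S\<^esub> a \<in> {r \<in> I. g r b = \<zero>}" if "a \<in> {r \<in> I. g r b = \<zero>}" for a
        using sm[of "\<ominus> \<one>" a] S.smult_l_minus[of \<one> a] that I.Icarr by simp
    qed
    then have "ideal {r \<in> I. g r b = \<zero>} R" using ideal_iff_submodule by blast
    then have "Idl A \<subseteq> {r \<in> I. g r b = \<zero>}"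
      by (rule genideal_minimal) (use AI that(1) in \<open>auto simp: T_def\<close>)
    then show ?thesis using A(3) that(2) by blast
  qed
  have "\<exists>w\<in>carrier R. \<forall>r\<in>I. g r b = r \<otimes> w" for b
    using self_injective I coord[of b] unfolding baer_def by fastforce
  then obtain w where w: "\<And>b. w b \<in> carrier R" "\<And>b r. r \<in> I \<Longrightarrow> g r b = r \<otimes> w b" by metis
  let ?w = "\<lambda>b. if b \<in> T then w b else \<zero>"
  show "\<exists>w\<in>carrier ?F. \<forall>r\<in>I. g r = r \<odot>\<^bsub>?F\<^esub> w"
  proof (intro bexI ballI)
    show "?w \<in> carrier ?F"
      unfolding free_mod_carrier
    proof (intro conjI)
      show "finite {b. ?w b \<noteq> \<zero>}" by (rule rev_finite_subset[OF finT]) auto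
    qed (use w(1) TB in auto)
    show "g r = r \<odot>\<^bsub>?F\<^esub> ?w" if "r \<in> I" for r
      using w(2)[OF that] off[OF _ that] I.Icarr[OF that] by auto
  qed
qed

end

lemma lift_from_free:
  assumes "module R M" "module R C" and q: "linear_map R M C q" "q ` carrier M = carrier C"
    and u: "u \<in> B \<rightarrow> carrier C"
  obtains v where "v \<in> B \<rightarrow> carrier M"
    "\<And>f. f \<in> carrier (free_mod R B) \<Longrightarrow> q (free_lift R M v f) = free_lift R C u f"
proof -
  define v where "v b = inv_into (carrier M) q (u b)" for b
  have v: "v b \<in> carrier M" "q (v b) = u b" if "b \<in> B" for b
    using u that q(2) unfolding v_def by (auto intro!: inv_into_into f_inv_into_f)
  have vc: "v \<in> B \<rightarrow> carrier M" using v(1) by blast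
  show ?thesis
  proof (rule that[OF vc])
    fix f assume f: "f \<in> carrier (free_mod R B)"
    show "q (free_lift R M v f) = free_lift R C u f"
      unfolding free_lift_comp[OF assms(1,2) q(1) vc f]
      by (rule free_lift_cong[OF assms(2) f u v(2)])
  qed
qed

text \<open>
  Projectivity as the splitting of the canonical surjection from a free module, a property that
  refers to no test modules and therefore yields liftings in all types (\<open>split_projective_lift\<close>).
\<close>

definition split_projective :: "('r, 's) ring_scheme \<Rightarrow> ('r, 'p) module \<Rightarrow> bool" where
  "split_projective R P \<longleftrightarrow> (\<exists>s. linear_map R P (free_mod R (carrier P)) s \<and>
     (\<forall>x\<in>carrier P. free_lift R P (\<lambda>x. x) (s x) = x))"

lemma projective_mod_split:
  fixes P :: "('r, 'p) module"
  assumes "projective_mod R P"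
  shows "split_projective R P"
proof -
  have mP: "module R P" using assms by (simp add: projective_mod_def)
  interpret P: module R P by (rule mP)
  let ?F = "free_mod R (carrier P)" and ?ev = "free_eval R P (carrier P)"
  have mF: "module R ?F" by (rule P.R.free_mod_module)
  have lin: "linear_map R ?F P ?ev" by (rule free_eval_linear[OF mP]) simp
  have ev: "?ev \<in> mod_Hom R ?F P"
    using lin unfolding mod_Hom_iff by (simp add: free_eval_def)
  have surj: "?ev ` carrier ?F = carrier P"
  proof
    show "?ev ` carrier ?F \<subseteq> carrier P" using linear_map_closed[OF lin] by blast
    show "carrier P \<subseteq> ?ev ` carrier ?F"
    proof
      fix x assume x: "x \<in> carrier P"
      show "x \<in> ?ev ` carrier ?F"
        by (rule image_eqI[where f = ?ev, OF free_eval_unit_vector[OF mP order_refl x, symmetric] P.R.unit_vector_closed[OF x]])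
    qed
  qed
  have id: "restrict (\<lambda>x. x) (carrier P) \<in> mod_Hom R P P"
    by (rule restrict_mod_Hom[OF linear_map_id mP])
  have "\<exists>g\<in>mod_Hom R P ?F. compose (carrier P) ?ev g = restrict (\<lambda>x. x) (carrier P)"
    using assms ev id mP mF surj unfolding projective_mod_def by blast
  then obtain g where g: "g \<in> mod_Hom R P ?F" "compose (carrier P) ?ev g = restrict (\<lambda>x. x) (carrier P)"
    by blast
  have lg: "linear_map R P ?F g" by (rule linear_map_mod_Hom[OF g(1)])
  have "free_lift R P (\<lambda>x. x) (g x) = x" if x: "x \<in> carrier P" for x
    using fun_cong[OF g(2), of x] x free_eval_eq[OF linear_map_closed[OF lg x], of P]
    by (simp add: compose_def)
  with lg show ?thesis unfolding split_projective_def by blast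
qed

lemma split_projective_lift:
  assumes "module R P" "module R B" "module R C" "split_projective R P"
    and q: "linear_map R B C q" "q ` carrier B = carrier C" and f: "linear_map R P C f"
  obtains g where "linear_map R P B g" "\<And>x. x \<in> carrier P \<Longrightarrow> q (g x) = f x"
proof -
  obtain s where s: "linear_map R P (free_mod R (carrier P)) s"
    "\<And>x. x \<in> carrier P \<Longrightarrow> free_lift R P (\<lambda>x. x) (s x) = x"
    using assms(4) unfolding split_projective_def by blast
  have u: "f \<in> carrier P \<rightarrow> carrier C" using linear_map_closed[OF f] by blast
  obtain v where v: "v \<in> carrier P \<rightarrow> carrier B"
    "\<And>h. h \<in> carrier (free_mod R (carrier P)) \<Longrightarrow> q (free_lift R B v h) = free_lift R C f h"
    by (rule lift_from_free[OF assms(2,3) q u]) blast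
  show ?thesis
  proof (rule that)
    show "linear_map R P B (\<lambda>x. free_lift R B v (s x))"
      by (rule linear_map_comp[OF s(1) free_lift_linear[OF assms(2) v(1)]])
    fix x assume x: "x \<in> carrier P"
    note sx = linear_map_closed[OF s(1) x]
    have "f (free_lift R P (\<lambda>x. x) (s x)) = free_lift R C f (s x)"
      by (rule free_lift_comp[OF assms(1,3) f _ sx]) simp
    then show "q (free_lift R B v (s x)) = f x" using v(2)[OF sx] s(2)[OF x] by simp
  qed
qed

context local_self_injective
begin

text \<open>
  A direct summand of a free module inherits injectivity from it.
\<close>

lemma split_projective_baer:
  fixes P :: "('a, 'p) module"
  assumes "module R P" "split_projective R P"
  shows "baer R P"
  unfolding baer_def
proof (intro allI impI, elim conjE)
  obtain s where s: "linear_map R P (free_mod R (carrier P)) s"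
    "\<And>x. x \<in> carrier P \<Longrightarrow> free_lift R P (\<lambda>x. x) (s x) = x"
    using assms(2) unfolding split_projective_def by blast
  have ev: "linear_map R (free_mod R (carrier P)) P (free_lift R P (\<lambda>x. x))"
    by (rule free_lift_linear[OF assms(1)]) simp
  fix I g assume I: "ideal I R" and g: "linear_map R ((self_module R)\<lparr>carrier := I\<rparr>) P g"
  obtain w where w: "w \<in> carrier (free_mod R (carrier P))"
    "\<And>r. r \<in> I \<Longrightarrow> s (g r) = r \<odot>\<^bsub>free_mod R (carrier P)\<^esub> w"
    using free_mod_baer[of "carrier P"] I linear_map_comp[OF g s(1)] unfolding baer_def by blast
  show "\<exists>w\<in>carrier P. \<forall>r\<in>I. g r = r \<odot>\<^bsub>P\<^esub> w"
  proof (intro bexI ballI)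
    show "free_lift R P (\<lambda>x. x) w \<in> carrier P" by (rule linear_map_closed[OF ev w(1)])
    fix r assume r: "r \<in> I"
    have "g r \<in> carrier P" using linear_map_closed[OF g] r by simp
    then have "g r = free_lift R P (\<lambda>x. x) (r \<odot>\<^bsub>free_mod R (carrier P)\<^esub> w)"
      using s(2) w(2)[OF r] by metis
    then show "g r = r \<odot>\<^bsub>P\<^esub> free_lift R P (\<lambda>x. x) w"
      using linear_map_smult[OF ev ideal.Icarr[OF I r] w(1)] by metis
  qed
qed

text \<open>
  Over a self-injective local Artinian ring an injective module \<open>E\<close> is free. Take a maximal independent set
  \<open>B\<close> in \<open>E\<close>. The submodule it spans is free, hence injective, so it is a direct summand with a retraction \<open>s\<close>
  onto the coordinates. If the complement \<open>ker s\<close> were nonzero, it would contain a nonzero \<open>x\<close> with \<open>m x = 0\<close>. Since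
  \<open>E\<close> is injective, \<open>x\<close> can be divided by the socle generator, \<open>x = \<sigma> c\<close>, with \<open>c\<close> in the complement.
  As every nonzero ideal contains \<open>\<sigma>\<close>, the element \<open>c\<close> has zero annihilator, so \<open>B \<union> {c}\<close> is
  independent.
\<close>

lemma baer_split_projective:
  fixes E :: "('a, 'e) module"
  assumes mE: "module R E" and baer: "baer R E"
  shows "split_projective R E"
proof -
  interpret E: module R E by (rule mE)
  obtain \<sigma> where \<sigma>: "\<sigma> \<in> carrier R" "\<sigma> \<noteq> \<zero>" "\<And>r. r \<in> m \<Longrightarrow> r \<otimes> \<sigma> = \<zero>"
    "\<And>r. r \<in> carrier R \<Longrightarrow> r \<noteq> \<zero> \<Longrightarrow> \<exists>t\<in>carrier R. t \<otimes> r = \<sigma>"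
    using socle_generator by blast
  let ?F = "\<lambda>B. free_mod R B"
  let ?ev = "free_lift R E (\<lambda>x. x)"
  define indep where "indep B \<longleftrightarrow> B \<subseteq> carrier E \<and> (\<forall>f\<in>carrier (?F B). ?ev f = \<zero>\<^bsub>E\<^esub> \<longrightarrow> f = (\<lambda>_. \<zero>))" for B
  have "\<exists>B\<in>{B. indep B}. \<forall>K\<in>{B. indep B}. B \<subseteq> K \<longrightarrow> K = B"
  proof (rule subset_Zorn_nonempty)
    have "indep {}" by (auto simp: indep_def free_mod_carrier)
    then show "{B. indep B} \<noteq> {}" by blast
    fix \<C> assume c: "\<C> \<noteq> {}" "subset.chain {B. indep B} \<C>"
    have ind: "indep B" if "B \<in> \<C>" for B using c(2) that by (auto simp: subset.chain_def)
    have "f = (\<lambda>_. \<zero>)" if f: "f \<in> carrier (?F (\<Union>\<C>))" "?ev f = \<zero>\<^bsub>E\<^esub>" for f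
    proof -
      have "finite {x. f x \<noteq> \<zero>}" "{x. f x \<noteq> \<zero>} \<subseteq> \<Union>\<C>" using f(1) by (auto simp: free_mod_carrier)
      then obtain B where B: "B \<in> \<C>" "{x. f x \<noteq> \<zero>} \<subseteq> B"
        using finite_subset_Union_chain[OF _ _ c] by blast
      have "f \<in> carrier (?F B)"
        using f(1) B free_mod_closed[OF f(1)] by (auto simp: free_mod_carrier)
      then show ?thesis using ind[OF B(1)] f(2) unfolding indep_def by blast
    qed
    then have "indep (\<Union>\<C>)" using ind unfolding indep_def by blast
    then show "\<Union>\<C> \<in> {B. indep B}" by simp
  qed
  then obtain B where B: "indep B" and max: "\<And>K. indep K \<Longrightarrow> B \<subseteq> K \<Longrightarrow> K = B" by blast
  have BE: "B \<subseteq> carrier E" using B unfolding indep_def by blast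
  have mF: "module R (?F B)" by (rule free_mod_module)
  interpret F: module R "?F B" by (rule mF)
  have idB: "(\<lambda>x. x) \<in> B \<rightarrow> carrier E" using BE by blast
  have ev: "linear_map R (?F B) E ?ev" by (rule free_lift_linear[OF mE idB])
  have inj: "inj_on ?ev (carrier (?F B))"
    by (rule linear_map_injI[OF mF mE ev]) (use B in \<open>auto simp: indep_def\<close>)
  obtain s where s: "linear_map R E (?F B) s" "\<And>f. f \<in> carrier (?F B) \<Longrightarrow> s (?ev f) = f"
    by (rule baer_extend_mono[OF mF mF mE free_mod_baer ev inj linear_map_id]) blast
  have ker: "a_kernel E (?F B) s = {\<zero>\<^bsub>E\<^esub>}"
  proof (rule ccontr)
    assume ne: "a_kernel E (?F B) s \<noteq> {\<zero>\<^bsub>E\<^esub>}"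
    have K: "submodule (a_kernel E (?F B) s) R E" by (rule kernel_submodule[OF mE mF s(1)])
    have "\<zero>\<^bsub>E\<^esub> \<in> a_kernel E (?F B) s" using linear_map_zero[OF mE mF s(1)] by (simp add: a_kernel_iff)
    then obtain x0 where x0: "x0 \<in> a_kernel E (?F B) s" "x0 \<noteq> \<zero>\<^bsub>E\<^esub>" using ne by blast
    let ?K = "E\<lparr>carrier := a_kernel E (?F B) s\<rparr>"
    have mK: "module R ?K" by (rule submodule_module[OF mE K])
    interpret K: module R ?K by (rule mK)
    have zK: "submodule {\<zero>\<^bsub>E\<^esub>} R ?K" "{\<zero>\<^bsub>E\<^esub>} \<noteq> carrier ?K"
    proof -
      have "submodule (a_kernel ?K ?K (\<lambda>x. x)) R ?K" by (rule kernel_submodule[OF mK mK linear_map_id])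
      moreover have "a_kernel ?K ?K (\<lambda>x. x) = {\<zero>\<^bsub>E\<^esub>}" using K.zero_closed by (auto simp: a_kernel_iff)
      ultimately show "submodule {\<zero>\<^bsub>E\<^esub>} R ?K" by simp
      show "{\<zero>\<^bsub>E\<^esub>} \<noteq> carrier ?K" using x0 by auto
    qed
    obtain x where x: "x \<in> carrier E" "s x = (\<lambda>_. \<zero>)" "x \<noteq> \<zero>\<^bsub>E\<^esub>" "\<And>r. r \<in> m \<Longrightarrow> r \<odot>\<^bsub>E\<^esub> x = \<zero>\<^bsub>E\<^esub>"
    proof (rule socle_element[OF mK zK])
      fix y assume y: "y \<in> carrier ?K" "y \<notin> {\<zero>\<^bsub>E\<^esub>}" "\<And>r. r \<in> m \<Longrightarrow> r \<odot>\<^bsub>?K\<^esub> y \<in> {\<zero>\<^bsub>E\<^esub>}"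
      show thesis by (rule that[of y]) (use y in \<open>simp_all add: a_kernel_iff\<close>)
    qed
    have mS: "module R (self_module R)" by (rule self_module_module)
    have \<sigma>S: "\<sigma> \<in> carrier (self_module R)" using \<sigma>(1) by simp
    have "r \<odot>\<^bsub>E\<^esub> x = \<zero>\<^bsub>E\<^esub>" if "r \<in> carrier R" "r \<odot>\<^bsub>self_module R\<^esub> \<sigma> = \<zero>\<^bsub>self_module R\<^esub>" for r
      using annihilator_subset_m[OF mS \<sigma>S _ that] \<sigma>(2) x(4) by simp
    then obtain g where g: "linear_map R (self_module R) E g" "g \<sigma> = x"
      by (rule baer_extend_cyclic[OF mE mS baer \<sigma>S x(1)])
    \<comment> \<open>Division of \<open>x\<close> by \<open>\<sigma>\<close>, followed by projection to the complement.\<close>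
    define w where "w = g \<one>"
    have w: "w \<in> carrier E" "\<sigma> \<odot>\<^bsub>E\<^esub> w = x"
      using linear_map_closed[OF g(1), of \<one>] linear_map_smult[OF g(1), of \<sigma> \<one>] g(2) \<sigma>(1)
      unfolding w_def by simp_all
    note sw = linear_map_closed[OF s(1) w(1)]
    note esw = linear_map_closed[OF ev sw]
    define c where "c = w \<ominus>\<^bsub>E\<^esub> ?ev (s w)"
    have c: "c \<in> carrier E" unfolding c_def using w(1) esw by simp
    have sc: "s c = (\<lambda>_. \<zero>)"
      using linear_map_diff[OF mE mF s(1) w(1) esw] s(2)[OF sw] minus_eq_zero_iff[OF mF sw sw]
      unfolding c_def by simp
    have \<sigma>c: "\<sigma> \<odot>\<^bsub>E\<^esub> c = x"
    proof -
      have "\<sigma> \<odot>\<^bsub>E\<^esub> ?ev (s w) = ?ev (s x)"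
        using linear_map_smult[OF ev \<sigma>(1) sw] linear_map_smult[OF s(1) \<sigma>(1) w(1)] w(2) by metis
      also have "\<dots> = \<zero>\<^bsub>E\<^esub>" using linear_map_zero[OF mF mE ev] x(2) by simp
      finally show ?thesis
        unfolding c_def a_minus_def using w esw \<sigma>(1) x(1) by (simp add: E.smult_r_distr E.smult_r_minus)
    qed
    have cB: "c \<notin> B"
    proof
      assume cB: "c \<in> B"
      have "s (?ev (unit_vector R c)) = unit_vector R c" by (rule s(2)[OF unit_vector_closed[OF cB]])
      then have "unit_vector R c = (\<lambda>_. \<zero>)"
        using free_lift_unit_vector[OF mE cB idB] sc by simp
      from fun_cong[OF this, of c] have "\<one> = \<zero>" by (simp add: unit_vector_def)
      then show False using one_not_in_m additive_subgroup.zero_closed[OF ideal.axioms(1)[OF m_ideal]] by simp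
    qed
    have "f = (\<lambda>_. \<zero>)" if f: "f \<in> carrier (?F (insert c B))" "?ev f = \<zero>\<^bsub>E\<^esub>" for f
    proof -
      let ?f = "f(c := \<zero>)"
      let ?S = "{x. ?f x \<noteq> \<zero>}"
      have f': "?f \<in> carrier (?F B)"
        unfolding free_mod_carrier
      proof (intro conjI)
        have "finite {x. f x \<noteq> \<zero>}" using f(1) by (simp add: free_mod_carrier)
        then show "finite ?S" by (rule rev_finite_subset) auto
      qed (use f(1) in \<open>auto simp: free_mod_carrier\<close>)
      have S: "finite ?S" "c \<notin> ?S" "?S \<subseteq> B" using f' by (auto simp: free_mod_carrier)
      have idc: "(\<lambda>x. x) \<in> insert c B \<rightarrow> carrier E" using idB c by blast
      have fc: "f y \<in> carrier R" for y using free_mod_closed[OF f(1)] .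
      have SE: "y \<in> carrier E" if "f y \<noteq> \<zero>" "y \<noteq> c" for y
      proof -
        have "y \<in> ?S" using that by simp
        then show ?thesis using S(3) BE by blast
      qed
      have "?ev f = (\<Oplus>\<^bsub>E\<^esub>y\<in>insert c ?S. f y \<odot>\<^bsub>E\<^esub> y)"
      proof (rule free_lift_superset[OF mE f(1) idc])
        show "finite (insert c ?S)" using S(1) by (rule finite.insertI)
        show "{x. f x \<noteq> \<zero>} \<subseteq> insert c ?S" by auto
        show "insert c ?S \<subseteq> insert c B" using S(3) by blast
      qed
      also have "\<dots> = f c \<odot>\<^bsub>E\<^esub> c \<oplus>\<^bsub>E\<^esub> (\<Oplus>\<^bsub>E\<^esub>y\<in>?S. f y \<odot>\<^bsub>E\<^esub> y)"
        by (rule E.finsum_insert[OF S(1,2)]) (use fc c SE in auto)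
      also have "(\<Oplus>\<^bsub>E\<^esub>y\<in>?S. f y \<odot>\<^bsub>E\<^esub> y) = ?ev ?f"
        unfolding free_lift_def by (rule E.finsum_cong') (use fc c SE in auto)
      finally have sum: "f c \<odot>\<^bsub>E\<^esub> c \<oplus>\<^bsub>E\<^esub> ?ev ?f = \<zero>\<^bsub>E\<^esub>" using f(2) by simp
      have fcc: "f c \<odot>\<^bsub>E\<^esub> c \<in> carrier E" using fc c by simp
      have eF: "?ev ?f \<in> carrier E" by (rule linear_map_closed[OF ev f'])
      have "s (f c \<odot>\<^bsub>E\<^esub> c \<oplus>\<^bsub>E\<^esub> ?ev ?f) = f c \<odot>\<^bsub>?F B\<^esub> s c \<oplus>\<^bsub>?F B\<^esub> ?f"
        using linear_map_add[OF s(1) fcc eF] linear_map_smult[OF s(1) fc c] s(2)[OF f'] by metis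
      then have eq: "(\<lambda>_. \<zero>) = f c \<odot>\<^bsub>?F B\<^esub> s c \<oplus>\<^bsub>?F B\<^esub> ?f"
        using linear_map_zero[OF mE mF s(1)] unfolding sum by simp
      have f0: "?f = (\<lambda>_. \<zero>)"
      proof
        fix y
        show "?f y = \<zero>"
          using fun_cong[OF eq, of y] fc free_mod_closed[OF f', of y] by (simp add: sc del: fun_upd_apply)
      qed
      then have "f c \<odot>\<^bsub>E\<^esub> c = \<zero>\<^bsub>E\<^esub>"
        using sum linear_map_zero[OF mF mE ev] fcc by simp
      have "f c = \<zero>"
      proof (rule ccontr)
        assume "f c \<noteq> \<zero>"
        then obtain t where t: "t \<in> carrier R" "t \<otimes> f c = \<sigma>" using \<sigma>(4) fc by blast
        then have "\<sigma> \<odot>\<^bsub>E\<^esub> c = t \<odot>\<^bsub>E\<^esub> (f c \<odot>\<^bsub>E\<^esub> c)" using fc c by (metis E.smult_assoc1)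
        then show False using \<open>f c \<odot>\<^bsub>E\<^esub> c = \<zero>\<^bsub>E\<^esub>\<close> t(1) \<sigma>c x(3) by simp
      qed
      then show ?thesis using f0 by (metis fun_upd_triv)
    qed
    then have "indep (insert c B)" unfolding indep_def using BE c by blast
    then have "insert c B = B" by (rule max) blast
    then show False using cB by blast
  qed
  have "linear_map R E (?F (carrier E)) s"
    using s(1) free_mod_mono[OF BE] by (auto simp: linear_map_def)
  moreover have "?ev (s x) = x" if x: "x \<in> carrier E" for x
  proof -
    note sx = linear_map_closed[OF s(1) x]
    note esx = linear_map_closed[OF ev sx]
    have "s (x \<ominus>\<^bsub>E\<^esub> ?ev (s x)) = \<zero>\<^bsub>?F B\<^esub>"
      using linear_map_diff[OF mE mF s(1) x esx] s(2)[OF sx] minus_eq_zero_iff[OF mF sx sx] by simp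
    then have "x \<ominus>\<^bsub>E\<^esub> ?ev (s x) \<in> a_kernel E (?F B) s" using x esx unfolding a_kernel_iff by simp
    then have "x \<ominus>\<^bsub>E\<^esub> ?ev (s x) = \<zero>\<^bsub>E\<^esub>" unfolding ker by simp
    then show ?thesis using minus_eq_zero_iff[OF mE x esx] by simp
  qed
  ultimately show ?thesis unfolding split_projective_def by blast
qed

end

section \<open>Vanishing of the first Ext group\<close>

definition extends_along ::
  "('r, 's) ring_scheme \<Rightarrow> ('r, 'a) module \<Rightarrow> ('a \<Rightarrow> 'b) \<Rightarrow> ('r, 'b) module \<Rightarrow> ('r, 'x) module \<Rightarrow> bool" where
  "extends_along R A i B Y \<longleftrightarrow>
     (\<forall>f. linear_map R A Y f \<longrightarrow> (\<exists>h. linear_map R B Y h \<and> (\<forall>a\<in>carrier A. h (i a) = f a)))"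

text \<open>
  The kernel of the canonical surjection from \<open>F\<^sub>0\<close> onto \<open>M\<close>, as a module.
\<close>

abbreviation relations :: "('r, 's) ring_scheme \<Rightarrow> ('r, 'm) module \<Rightarrow> ('r, 'm \<Rightarrow> 'r) module" where
  "relations R M \<equiv> (res0 R M)\<lparr>carrier := res_ker0 R M\<rparr>"

text \<open>
  By the exact sequence \<open>Hom(F\<^sub>0, Y) \<rightarrow> Hom(K\<^sub>0, Y) \<rightarrow> Ext\<^sup>1(M, Y) \<rightarrow> 0\<close>, where \<open>K\<^sub>0\<close> is the kernel of \<open>F\<^sub>0 \<rightarrow> M\<close>, this is
  the vanishing of \<open>Ext\<^sup>1(M, Y)\<close>.
\<close>

definition Ext1_vanishes :: "('r, 's) ring_scheme \<Rightarrow> ('r, 'm) module \<Rightarrow> ('r, 'x) module \<Rightarrow> bool" where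
  "Ext1_vanishes R M Y \<longleftrightarrow> extends_along R (relations R M) (\<lambda>k. k) (res0 R M) Y"

abbreviation res_eval :: "('r, 's) ring_scheme \<Rightarrow> ('r, 'm) module \<Rightarrow> ('m \<Rightarrow> 'r) \<Rightarrow> 'm" where
  "res_eval R M \<equiv> free_lift R M (\<lambda>x. x)"

lemma short_exactD:
  assumes "short_exact R A i B p C"
  shows "module R A" "module R B" "module R C" "linear_map R A B i" "linear_map R B C p"
    "inj_on i (carrier A)" "i ` carrier A = a_kernel B C p" "p ` carrier B = carrier C"
  using assms linear_map_mod_Hom unfolding short_exact_def by blast+

lemma res0_module: "module R M \<Longrightarrow> module R (res0 R M)"
  unfolding res0_def by (rule cring.free_mod_module) (rule module.axioms(1))

lemma res_eval_linear: "module R M \<Longrightarrow> linear_map R (res0 R M) M (res_eval R M)"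
  unfolding res0_def by (rule free_lift_linear) simp_all

lemma res_eval_surj:
  assumes "module R M"
  shows "res_eval R M ` carrier (res0 R M) = carrier M"
proof
  interpret M: module R M by fact
  show "res_eval R M ` carrier (res0 R M) \<subseteq> carrier M"
    using linear_map_closed[OF res_eval_linear[OF assms]] by blast
  show "carrier M \<subseteq> res_eval R M ` carrier (res0 R M)"
  proof
    fix x assume x: "x \<in> carrier M"
    have "unit_vector R x \<in> carrier (res0 R M)"
      unfolding res0_def by (rule M.R.unit_vector_closed[OF x])
    moreover have "res_eval R M (unit_vector R x) = x"
      by (rule free_lift_unit_vector[OF assms x]) simp
    ultimately show "x \<in> res_eval R M ` carrier (res0 R M)" by (metis imageI)
  qed
qed

lemma res_ker0_iff:
  "k \<in> res_ker0 R M \<longleftrightarrow> k \<in> carrier (res0 R M) \<and> res_eval R M k = \<zero>\<^bsub>M\<^esub>"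
  by (auto simp: res_ker0_def a_kernel_iff res0_def free_eval_eq)

lemma res_ker0_submodule:
  assumes "module R M"
  shows "submodule (res_ker0 R M) R (res0 R M)"
proof -
  have "res_ker0 R M = a_kernel (res0 R M) M (res_eval R M)" by (auto simp: res_ker0_iff a_kernel_iff)
  then show ?thesis
    using kernel_submodule[OF res0_module[OF assms] assms res_eval_linear[OF assms]] by simp
qed

lemma relations_module: "module R M \<Longrightarrow> module R (relations R M)"
  by (rule submodule_module[OF res0_module res_ker0_submodule])

lemma free_lift_kernel:
  assumes "module R F" "module R M" "linear_map R F M e" "x \<in> carrier (free_mod R (a_kernel F M e))"
  shows "e (free_lift R F (\<lambda>x. x) x) = \<zero>\<^bsub>M\<^esub>"
proof -
  interpret M: module R M by fact
  have id: "(\<lambda>x. x) \<in> a_kernel F M e \<rightarrow> carrier F" by (auto simp: a_kernel_iff)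
  have "e (free_lift R F (\<lambda>x. x) x) = free_lift R M (\<lambda>x. e x) x"
    by (rule free_lift_comp[OF assms(1-3) id assms(4)])
  also have "\<dots> = free_lift R M (\<lambda>_. \<zero>\<^bsub>M\<^esub>) x"
    by (rule free_lift_cong[OF assms(2,4)]) (auto simp: a_kernel_iff)
  also have "\<dots> = \<zero>\<^bsub>M\<^esub>"
    unfolding free_lift_def
    using M.R.free_mod_closed[OF assms(4)] by (intro M.add.finprod_one_eqI) simp
  finally show ?thesis .
qed

text \<open>
  A map \<open>f\<close> on the kernel \<open>K\<^sub>0\<close> of \<open>F\<^sub>0 \<rightarrow> M\<close> yields the cocycle \<open>f \<circ> d\<^sub>1\<close>. If it is a coboundary \<open>h \<circ> d\<^sub>1\<close>, then \<open>h\<close>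
  extends \<open>f\<close>, because \<open>d\<^sub>1\<close> maps the basis of \<open>F\<^sub>1\<close> bijectively onto \<open>K\<^sub>0\<close>.
\<close>

lemma Ext1_trivial_imp_vanishes:
  assumes mM: "module R M" and mN: "module R N"
    and triv: "carrier (Ext1 R M N) = {\<one>\<^bsub>Ext1 R M N\<^esub>}"
  shows "Ext1_vanishes R M N"
  unfolding Ext1_vanishes_def extends_along_def
proof (intro allI impI)
  interpret M: module R M by (rule mM)
  interpret N: module R N by (rule mN)
  let ?F0 = "res0 R M" and ?F1 = "res1 R M" and ?F2 = "res2 R M" and ?d1 = "res_d1 R M" and ?d2 = "res_d2 R M"
  let ?K0 = "res_ker0 R M" and ?K1 = "res_ker1 R M"
  fix f assume f: "linear_map R (relations R M) N f"
  have m0: "module R ?F0" by (rule res0_module[OF mM])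
  have m1: "module R ?F1" unfolding res1_def by (rule M.R.free_mod_module)
  have m2: "module R ?F2" unfolding res2_def by (rule M.R.free_mod_module)
  have K0: "?K0 \<subseteq> carrier ?F0" by (auto simp: res_ker0_iff)
  have K1: "?K1 \<subseteq> carrier ?F1" by (auto simp: res_ker1_def a_kernel_iff)
  have ev: "linear_map R ?F0 M (free_eval R M (carrier M))"
    unfolding res0_def by (rule free_eval_linear[OF mM]) simp
  have d1: "linear_map R ?F1 ?F0 ?d1"
    unfolding res1_def res_d1_def by (rule free_eval_linear[OF m0 K0])
  have d2: "linear_map R ?F2 ?F1 ?d2"
    unfolding res2_def res_d2_def by (rule free_eval_linear[OF m1 K1])
  have d1K: "?d1 x \<in> ?K0" if x: "x \<in> carrier ?F1" for x
    using free_lift_kernel[OF m0 mM ev, of x] linear_map_closed[OF d1 x] x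
    by (simp add: res_ker0_def a_kernel_iff res1_def res_d1_def free_eval_eq)
  have d12: "?d1 (?d2 x) = \<zero>\<^bsub>?F0\<^esub>" if x: "x \<in> carrier ?F2" for x
    using free_lift_kernel[OF m1 m0 d1, of x] x
    by (simp add: res_ker1_def res2_def res_d2_def free_eval_eq)
  have "linear_map R ?F1 (relations R M) ?d1"
    by (rule linear_map_codomain[OF d1]) (use d1K in blast)
  then have fd: "linear_map R ?F1 N (\<lambda>x. f (?d1 x))" using f by (rule linear_map_comp)
  define g where "g = restrict (\<lambda>x. f (?d1 x)) (carrier ?F1)"
  have g: "g \<in> mod_Hom R ?F1 N" unfolding g_def by (rule restrict_mod_Hom[OF fd m1])
  have f0: "f \<zero>\<^bsub>?F0\<^esub> = \<zero>\<^bsub>N\<^esub>" using linear_map_zero[OF relations_module[OF mM] mN f] by simp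
  have fd0: "f (?d1 (?d2 x)) = \<zero>\<^bsub>N\<^esub>" if "x \<in> carrier ?F2" for x
    unfolding d12[OF that] by (rule f0)
  have "compose (carrier ?F2) g ?d2 = (\<lambda>x\<in>carrier ?F2. \<zero>\<^bsub>N\<^esub>)"
    using linear_map_closed[OF d2] fd0 by (auto simp: compose_def g_def restrict_def fun_eq_iff)
  then have cocycle: "g \<in> cocycles1 R M N"
    using g by (simp add: cocycles1_def kernel_def hom_group_def)
  let ?zero = "\<lambda>x\<in>carrier ?F1. \<zero>\<^bsub>N\<^esub>"
  let ?B = "coboundaries1 R M N"
  have "linear_map R ?F0 N (\<lambda>_. \<zero>\<^bsub>N\<^esub>)" by (rule linear_mapI) auto
  then have "restrict (\<lambda>_. \<zero>\<^bsub>N\<^esub>) (carrier ?F0) \<in> mod_Hom R ?F0 N" by (rule restrict_mod_Hom[OF _ m0])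
  moreover have "?zero = compose (carrier ?F1) (restrict (\<lambda>_. \<zero>\<^bsub>N\<^esub>) (carrier ?F0)) ?d1"
    using linear_map_closed[OF d1] by (auto simp: compose_def restrict_def fun_eq_iff)
  ultimately have zero: "?zero \<in> ?B" unfolding coboundaries1_def by blast
  let ?G = "(hom_group R ?F1 N)\<lparr>carrier := cocycles1 R M N\<rparr>"
  \<comment> \<open>The coset of \<open>g\<close> contains \<open>g\<close>, and there is only one coset.\<close>
  have "?B #>\<^bsub>?G\<^esub> g \<in> carrier (Ext1 R M N)"
    unfolding Ext1_def FactGroup_def RCOSETS_def using cocycle by auto
  then have "?B #>\<^bsub>?G\<^esub> g = ?B" using triv by (simp add: Ext1_def FactGroup_def)
  moreover have "?zero \<otimes>\<^bsub>?G\<^esub> g \<in> ?B #>\<^bsub>?G\<^esub> g" using zero unfolding r_coset_def by blast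
  moreover have "?zero \<otimes>\<^bsub>?G\<^esub> g = g"
    using linear_map_closed[OF fd] by (auto simp: hom_group_def g_def restrict_def fun_eq_iff)
  ultimately have "g \<in> ?B" by simp
  then obtain h where h: "h \<in> mod_Hom R ?F0 N" "g = compose (carrier ?F1) h ?d1"
    unfolding coboundaries1_def by blast
  show "\<exists>h. linear_map R ?F0 N h \<and> (\<forall>k\<in>carrier (relations R M). h k = f k)"
  proof (intro exI conjI ballI)
    show "linear_map R ?F0 N h" by (rule linear_map_mod_Hom[OF h(1)])
    fix k assume "k \<in> carrier (relations R M)"
    then have k: "k \<in> ?K0" by simp
    have e: "unit_vector R k \<in> carrier ?F1" unfolding res1_def by (rule M.R.unit_vector_closed[OF k])
    have "?d1 (unit_vector R k) = k" unfolding res_d1_def by (rule free_eval_unit_vector[OF m0 K0 k])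
    then show "h k = f k" using fun_cong[OF h(2), of "unit_vector R k"] e by (simp add: compose_def g_def)
  qed
qed

text \<open>
  If \<open>Ext\<^sup>1(M, A) = 0\<close>, every map from \<open>M\<close> to the cokernel of \<open>j\<close> lifts to \<open>B\<close>. To avoid the cokernel,
  the given map is represented by \<open>l\<close> on the free module over \<open>M\<close>: the restriction of \<open>l\<close> to the relations takes values in \<open>A\<close>;
  subtracting from \<open>l\<close> an extension of this restriction leaves a map that factors through \<open>M\<close>.
\<close>

lemma Ext1_vanishes_lift_modulo:
  assumes mM: "module R M" and mA: "module R A" and mB: "module R B"
    and j: "linear_map R A B j" "inj_on j (carrier A)"
    and l: "linear_map R (res0 R M) B l" "\<And>k. k \<in> res_ker0 R M \<Longrightarrow> l k \<in> j ` carrier A"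
    and van: "Ext1_vanishes R M A"
  obtains d where "linear_map R M B d"
    "\<And>f. f \<in> carrier (res0 R M) \<Longrightarrow> l f \<ominus>\<^bsub>B\<^esub> d (res_eval R M f) \<in> j ` carrier A"
proof -
  interpret B: module R B by (rule mB)
  have m0: "module R (res0 R M)" by (rule res0_module[OF mM])
  have mK: "module R (relations R M)" by (rule relations_module[OF mM])
  have K: "res_ker0 R M \<subseteq> carrier (res0 R M)" by (auto simp: res_ker0_iff)
  obtain f where f: "linear_map R (relations R M) A f"
    "\<And>k. k \<in> carrier (relations R M) \<Longrightarrow> j (f k) = l k"
    by (rule factor_through_injection[OF mK mA mB j linear_map_subset[OF l(1) K]]) (use l(2) in auto)
  obtain h where h: "linear_map R (res0 R M) A h" "\<And>k. k \<in> res_ker0 R M \<Longrightarrow> h k = f k"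
    using van f(1) unfolding Ext1_vanishes_def extends_along_def by auto
  have jh: "linear_map R (res0 R M) B (\<lambda>x. j (h x))" by (rule linear_map_comp[OF h(1) j(1)])
  have diff: "linear_map R (res0 R M) B (\<lambda>x. l x \<ominus>\<^bsub>B\<^esub> j (h x))"
    by (rule linear_map_sub[OF m0 mB l(1) jh])
  have kills: "l x \<ominus>\<^bsub>B\<^esub> j (h x) = \<zero>\<^bsub>B\<^esub>" if x: "x \<in> carrier (res0 R M)" "res_eval R M x = \<zero>\<^bsub>M\<^esub>" for x
  proof -
    have k: "x \<in> res_ker0 R M" using x by (simp add: res_ker0_iff)
    have "j (h x) = l x" using h(2)[OF k] f(2) k by simp
    then show ?thesis using minus_eq_zero_iff[OF mB] linear_map_closed[OF l(1) x(1)] by simp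
  qed
  obtain d where d: "linear_map R M B d"
    "\<And>x. x \<in> carrier (res0 R M) \<Longrightarrow> d (res_eval R M x) = l x \<ominus>\<^bsub>B\<^esub> j (h x)"
    by (rule factor_through_surjection[OF m0 mM mB res_eval_linear[OF mM] res_eval_surj[OF mM] diff])
      (use kills in blast)+
  show ?thesis
  proof (rule that[OF d(1)])
    fix x assume x: "x \<in> carrier (res0 R M)"
    note lx = linear_map_closed[OF l(1) x] and jx = linear_map_closed[OF jh x]
    have "l x \<ominus>\<^bsub>B\<^esub> d (res_eval R M x) = j (h x)"
      unfolding d(2)[OF x] using lx jx
      by (simp add: a_minus_def B.minus_add B.a_assoc[symmetric] B.r_neg)
    then show "l x \<ominus>\<^bsub>B\<^esub> d (res_eval R M x) \<in> j ` carrier A"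
      using linear_map_closed[OF h(1) x] by auto
  qed
qed

lemma Ext1_vanishes_lift:
  assumes ex: "short_exact R A j B p C" and mM: "module R M" and van: "Ext1_vanishes R M A"
    and f: "linear_map R M C f"
  obtains d where "linear_map R M B d" "\<And>x. x \<in> carrier M \<Longrightarrow> p (d x) = f x"
proof -
  note e = short_exactD[OF ex]
  interpret M: module R M by (rule mM)
  have u: "f \<in> carrier M \<rightarrow> carrier C" using linear_map_closed[OF f] by blast
  obtain v where v: "v \<in> carrier M \<rightarrow> carrier B"
    "\<And>x. x \<in> carrier (free_mod R (carrier M)) \<Longrightarrow> p (free_lift R B v x) = free_lift R C f x"
    by (rule lift_from_free[OF e(2,3,5,8) u]) blast
  let ?l = "free_lift R B v"
  have l: "linear_map R (res0 R M) B ?l" unfolding res0_def by (rule free_lift_linear[OF e(2) v(1)])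
  have pl: "p (?l x) = f (res_eval R M x)" if "x \<in> carrier (res0 R M)" for x
  proof -
    have x: "x \<in> carrier (free_mod R (carrier M))" using that by (simp add: res0_def)
    have "f (res_eval R M x) = free_lift R C (\<lambda>x. f x) x"
      by (rule free_lift_comp[OF mM e(3) f _ x]) simp
    then show ?thesis using v(2)[OF x] by simp
  qed
  have lk: "?l k \<in> j ` carrier A" if "k \<in> res_ker0 R M" for k
    using that pl[of k] linear_map_closed[OF l] linear_map_zero[OF mM e(3) f]
    unfolding e(7) res_ker0_iff a_kernel_iff by auto
  obtain d where d: "linear_map R M B d"
    "\<And>x. x \<in> carrier (res0 R M) \<Longrightarrow> ?l x \<ominus>\<^bsub>B\<^esub> d (res_eval R M x) \<in> j ` carrier A"
    by (rule Ext1_vanishes_lift_modulo[OF mM e(1,2,4,6) l _ van]) (use lk in blast)+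
  show ?thesis
  proof (rule that[OF d(1)])
    fix x assume "x \<in> carrier M"
    then obtain z where z: "z \<in> carrier (res0 R M)" "x = res_eval R M z"
      using res_eval_surj[OF mM] by blast
    have dx: "d x \<in> carrier B" using linear_map_closed[OF d(1)] \<open>x \<in> carrier M\<close> by blast
    have "p (?l z \<ominus>\<^bsub>B\<^esub> d x) = \<zero>\<^bsub>C\<^esub>" using d(2)[OF z(1)] unfolding e(7) a_kernel_iff z(2) by blast
    then have "p (?l z) = p (d x)"
      using linear_map_diff[OF e(2,3,5) linear_map_closed[OF l z(1)] dx]
        minus_eq_zero_iff[OF e(3)] linear_map_closed[OF e(5)] linear_map_closed[OF l z(1)] dx by simp
    then show "p (d x) = f x" using pl[OF z(1)] z(2) by simp
  qed
qed

text \<open>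
  The comparison of two presentations of \<open>N\<close>, as in Schanuel's lemma. The map \<open>\<phi> \<circ> \<psi> - id\<close> of \<open>Q\<close> takes
  values in \<open>L\<close>; call it \<open>\<delta>\<close>. Given \<open>f\<close> on \<open>L\<close>, pull it back to \<open>K\<close> along \<open>\<phi>\<close>, extend it to \<open>h\<^sub>0\<close> on \<open>P\<close>, and correct by \<open>\<delta>\<close>: the
  map \<open>h\<^sub>0 \<circ> \<psi> - f \<circ> \<delta>\<close> extends \<open>f\<close>.
\<close>

lemma extends_along_transfer:
  assumes ex: "short_exact R K i P p N" and ex': "short_exact R L j Q q N" and mY: "module R Y"
    and \<phi>: "linear_map R P Q \<phi>" "\<And>x. x \<in> carrier P \<Longrightarrow> q (\<phi> x) = p x"
    and \<psi>: "linear_map R Q P \<psi>" "\<And>x. x \<in> carrier Q \<Longrightarrow> p (\<psi> x) = q x"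
    and ext: "extends_along R K i P Y"
  shows "extends_along R L j Q Y"
  unfolding extends_along_def
proof (intro allI impI)
  note e = short_exactD[OF ex] and e' = short_exactD[OF ex']
  interpret Y: module R Y by (rule mY)
  interpret Q: module R Q by (rule e'(2))
  interpret L: module R L by (rule e'(1))
  fix f assume f: "linear_map R L Y f"
  have \<phi>i: "linear_map R K Q (\<lambda>k. \<phi> (i k))" by (rule linear_map_comp[OF e(4) \<phi>(1)])
  have "(\<lambda>k. \<phi> (i k)) ` carrier K \<subseteq> j ` carrier L"
  proof
    fix y assume "y \<in> (\<lambda>k. \<phi> (i k)) ` carrier K"
    then obtain k where k: "k \<in> carrier K" "y = \<phi> (i k)" by blast
    have "i k \<in> a_kernel P N p" using e(7) k(1) by blast
    then show "y \<in> j ` carrier L"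
      unfolding e'(7) a_kernel_iff using k \<phi>(2) linear_map_closed[OF \<phi>(1)] by simp
  qed
  then obtain \<phi>' where \<phi>': "linear_map R K L \<phi>'" "\<And>k. k \<in> carrier K \<Longrightarrow> j (\<phi>' k) = \<phi> (i k)"
    by (rule factor_through_injection[OF e(1) e'(1,2,4,6) \<phi>i]) blast
  obtain h0 where h0: "linear_map R P Y h0" "\<And>k. k \<in> carrier K \<Longrightarrow> h0 (i k) = f (\<phi>' k)"
    using ext linear_map_comp[OF \<phi>'(1) f] unfolding extends_along_def by blast
  have \<phi>\<psi>: "linear_map R Q Q (\<lambda>x. \<phi> (\<psi> x))" by (rule linear_map_comp[OF \<psi>(1) \<phi>(1)])
  have diff: "linear_map R Q Q (\<lambda>x. \<phi> (\<psi> x) \<ominus>\<^bsub>Q\<^esub> x)"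
    by (rule linear_map_sub[OF e'(2,2) \<phi>\<psi> linear_map_id])
  have "(\<lambda>x. \<phi> (\<psi> x) \<ominus>\<^bsub>Q\<^esub> x) ` carrier Q \<subseteq> j ` carrier L"
  proof
    fix y assume "y \<in> (\<lambda>x. \<phi> (\<psi> x) \<ominus>\<^bsub>Q\<^esub> x) ` carrier Q"
    then obtain x where x: "x \<in> carrier Q" "y = \<phi> (\<psi> x) \<ominus>\<^bsub>Q\<^esub> x" by blast
    note \<psi>x = linear_map_closed[OF \<psi>(1) x(1)]
    have "q y = \<zero>\<^bsub>N\<^esub>"
      unfolding x(2) linear_map_diff[OF e'(2,3,5) linear_map_closed[OF \<phi>(1) \<psi>x] x(1)]
        \<phi>(2)[OF \<psi>x] \<psi>(2)[OF x(1)]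
      using minus_eq_zero_iff[OF e'(3)] linear_map_closed[OF e'(5) x(1)] by blast
    moreover have "y \<in> carrier Q" using linear_map_closed[OF diff x(1)] x(2) by simp
    ultimately show "y \<in> j ` carrier L" unfolding e'(7) a_kernel_iff by simp
  qed
  then obtain \<delta> where \<delta>: "linear_map R Q L \<delta>" "\<And>x. x \<in> carrier Q \<Longrightarrow> j (\<delta> x) = \<phi> (\<psi> x) \<ominus>\<^bsub>Q\<^esub> x"
    by (rule factor_through_injection[OF e'(2,1,2,4,6) diff]) blast
  let ?h = "\<lambda>x. h0 (\<psi> x) \<ominus>\<^bsub>Y\<^esub> f (\<delta> x)"
  have "linear_map R Q Y ?h"
    by (rule linear_map_sub[OF e'(2) mY linear_map_comp[OF \<psi>(1) h0(1)] linear_map_comp[OF \<delta>(1) f]])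
  moreover have "?h (j l) = f l" if l: "l \<in> carrier L" for l
  proof -
    have jl: "j l \<in> carrier Q" by (rule linear_map_closed[OF e'(4) l])
    have "q (j l) = \<zero>\<^bsub>N\<^esub>" using e'(7) l a_kernel_iff by (metis imageI)
    then have "\<psi> (j l) \<in> a_kernel P N p"
      using \<psi>(2)[OF jl] linear_map_closed[OF \<psi>(1) jl] by (simp add: a_kernel_iff)
    then obtain k where k: "k \<in> carrier K" "\<psi> (j l) = i k" using e(7) by (metis imageE)
    note \<delta>l = linear_map_closed[OF \<delta>(1) jl] and \<phi>k = linear_map_closed[OF \<phi>'(1) k(1)]
    have "j (\<delta> (j l) \<oplus>\<^bsub>L\<^esub> l) = (\<phi> (\<psi> (j l)) \<ominus>\<^bsub>Q\<^esub> j l) \<oplus>\<^bsub>Q\<^esub> j l"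
      using linear_map_add[OF e'(4) \<delta>l l] \<delta>(2)[OF jl] by simp
    also have "\<dots> = \<phi> (\<psi> (j l))"
      using linear_map_closed[OF \<phi>\<psi> jl] jl by (simp add: a_minus_def Q.a_assoc Q.l_neg)
    also have "\<dots> = j (\<phi>' k)" using \<phi>'(2)[OF k(1)] k(2) by simp
    finally have "\<delta> (j l) \<oplus>\<^bsub>L\<^esub> l = \<phi>' k"
      using inj_onD[OF e'(6)] \<phi>k \<delta>l l by (meson L.a_closed)
    then have "h0 (\<psi> (j l)) = f (\<delta> (j l)) \<oplus>\<^bsub>Y\<^esub> f l"
      using h0(2)[OF k(1)] k(2) linear_map_add[OF f \<delta>l l] by simp
    then show ?thesis
      using linear_map_closed[OF f \<delta>l] linear_map_closed[OF f l]
      by (simp add: a_minus_def Y.a_ac Y.r_neg)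
  qed
  ultimately show "\<exists>h. linear_map R Q Y h \<and> (\<forall>a\<in>carrier L. h (j a) = f a)" by blast
qed

text \<open>
  The first Ext group can be computed from any presentation by a projective module, because maps over \<open>N\<close> between
  \<open>P\<close> and the canonical free module exist in both directions.
\<close>

lemma Ext1_vanishes_iff_extends:
  assumes ex: "short_exact R K i P p N" and sp: "split_projective R P" and mY: "module R Y"
  shows "Ext1_vanishes R N Y \<longleftrightarrow> extends_along R K i P Y"
proof -
  note e = short_exactD[OF ex]
  interpret N: module R N by (rule e(3))
  have m0: "module R (res0 R N)" by (rule res0_module[OF e(3)])
  let ?ev = "restrict (res_eval R N) (carrier (res0 R N))"
  let ?id = "restrict (\<lambda>k. k) (res_ker0 R N)"
  have ev: "?ev \<in> mod_Hom R (res0 R N) N" by (rule restrict_mod_Hom[OF res_eval_linear[OF e(3)] m0])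
  have K: "res_ker0 R N \<subseteq> carrier (res0 R N)" by (auto simp: res_ker0_iff)
  have id: "?id \<in> mod_Hom R (relations R N) (res0 R N)"
    using restrict_mod_Hom[OF linear_map_subset[OF linear_map_id K] relations_module[OF e(3)]] by simp
  have surj: "?ev ` carrier (res0 R N) = carrier N" using res_eval_surj[OF e(3)] by simp
  have ex0: "short_exact R (relations R N) ?id (res0 R N) ?ev N"
    unfolding short_exact_def using ev id surj m0 e(3) relations_module[OF e(3)] K
    by (auto simp: inj_on_def a_kernel_iff res_ker0_iff)
  have same: "extends_along R (relations R N) ?id (res0 R N) Y \<longleftrightarrow> Ext1_vanishes R N Y"
    unfolding Ext1_vanishes_def extends_along_def by simp
  obtain \<psi> where \<psi>: "linear_map R P (res0 R N) \<psi>" "\<And>x. x \<in> carrier P \<Longrightarrow> ?ev (\<psi> x) = p x"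
    by (rule split_projective_lift[OF e(2) m0 e(3) sp linear_map_mod_Hom[OF ev] surj e(5)]) blast
  obtain v where v: "v \<in> carrier N \<rightarrow> carrier P"
    "\<And>f. f \<in> carrier (free_mod R (carrier N)) \<Longrightarrow> p (free_lift R P v f) = free_lift R N (\<lambda>x. x) f"
    by (rule lift_from_free[OF e(2,3,5,8), of "\<lambda>x. x" "carrier N"]) auto
  have \<phi>: "linear_map R (res0 R N) P (free_lift R P v)"
    unfolding res0_def by (rule free_lift_linear[OF e(2) v(1)])
  have p\<phi>: "p (free_lift R P v x) = ?ev x" if "x \<in> carrier (res0 R N)" for x
    using v(2) that by (simp add: res0_def)
  show ?thesis
    unfolding same[symmetric]
  proof
    assume h: "extends_along R (relations R N) ?id (res0 R N) Y"
    show "extends_along R K i P Y"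
      by (rule extends_along_transfer[OF ex0 ex mY \<phi> _ \<psi>(1) _ h]) (use \<psi>(2) p\<phi> in auto)
  next
    assume h: "extends_along R K i P Y"
    show "extends_along R (relations R N) ?id (res0 R N) Y"
      by (rule extends_along_transfer[OF ex ex0 mY \<psi>(1) _ \<phi> _ h]) (use \<psi>(2) p\<phi> in auto)
  qed
qed

section \<open>Syzygies and cosyzygies\<close>

context local_self_injective
begin

text \<open>
  For \<open>0 \<rightarrow> K \<rightarrow> P \<rightarrow> N \<rightarrow> 0\<close>, a map \<open>K \<rightarrow> N\<close> lifts to \<open>K \<rightarrow> P\<close> since \<open>Ext\<^sup>1(K, K) = 0\<close>. The lift extends to \<open>P \<rightarrow> P\<close>
  since \<open>P\<close> is injective, and composing with \<open>P \<rightarrow> N\<close> extends the original map to \<open>P\<close>.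
\<close>

lemma Ext1_vanishes_of_syzygy:
  fixes K P N :: "('a, 'm) module"
  assumes "syzygy_step R N K" and van: "Ext1_vanishes R K K"
  shows "Ext1_vanishes R N N"
proof -
  obtain P :: "('a, 'm) module" and p i where P: "projective_cover R P p N" and ex: "short_exact R K i P p N"
    using assms(1) unfolding syzygy_step_def by blast
  note e = short_exactD[OF ex]
  have sp: "split_projective R P" using P projective_mod_split unfolding projective_cover_def by blast
  have baer: "baer R P" by (rule split_projective_baer[OF e(2) sp])
  show ?thesis
    unfolding Ext1_vanishes_iff_extends[OF ex sp e(3)] extends_along_def
  proof (intro allI impI)
    fix f assume f: "linear_map R K N f"
    obtain d where d: "linear_map R K P d" "\<And>x. x \<in> carrier K \<Longrightarrow> p (d x) = f x"
      by (rule Ext1_vanishes_lift[OF ex e(1) van f]) blast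
    obtain g where g: "linear_map R P P g" "\<And>x. x \<in> carrier K \<Longrightarrow> g (i x) = d x"
      by (rule baer_extend_mono[OF e(2,1,2) baer e(4,6) d(1)]) blast
    show "\<exists>h. linear_map R P N h \<and> (\<forall>a\<in>carrier K. h (i a) = f a)"
      using linear_map_comp[OF g(1) e(5)] g(2) d(2) by (intro exI[of _ "\<lambda>x. p (g x)"]) simp
  qed
qed

text \<open>
  For \<open>0 \<rightarrow> N \<rightarrow> E \<rightarrow> C \<rightarrow> 0\<close>, a map \<open>N \<rightarrow> C\<close> extends to \<open>E \<rightarrow> C\<close> since \<open>Ext\<^sup>1(C, C) = 0\<close>, and the extension lifts to
  \<open>E \<rightarrow> E\<close> since \<open>E\<close> is projective. So every map \<open>N \<rightarrow> C\<close> lifts to \<open>N \<rightarrow> E\<close>, which is the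
  vanishing of \<open>Ext\<^sup>1(N, N)\<close> because \<open>E\<close> is injective.
\<close>

lemma Ext1_vanishes_of_cosyzygy:
  fixes N C :: "('a, 'm) module"
  assumes "cosyzygy_step R N C" and van: "Ext1_vanishes R C C"
  shows "Ext1_vanishes R N N"
proof -
  obtain E :: "('a, 'm) module" and i p where E: "injective_hull R N i E" and ex: "short_exact R N i E p C"
    using assms(1) unfolding cosyzygy_step_def by blast
  note e = short_exactD[OF ex]
  have baer: "baer R E"
    using E injective_mod_baer[OF is_cring] unfolding injective_hull_def by blast
  have sp: "split_projective R E" by (rule baer_split_projective[OF e(2) baer])
  have ext: "extends_along R N i E C" using van Ext1_vanishes_iff_extends[OF ex sp e(3)] by blast
  have m0: "module R (res0 R N)" by (rule res0_module[OF e(1)])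
  interpret E: module R E by (rule e(2))
  show ?thesis
    unfolding Ext1_vanishes_def extends_along_def
  proof (intro allI impI)
    fix f assume f: "linear_map R (relations R N) N f"
    obtain g where g: "linear_map R (res0 R N) E g" "\<And>k. k \<in> res_ker0 R N \<Longrightarrow> g k = i (f k)"
      by (rule baer_extend[OF e(2) m0 baer res_ker0_submodule[OF e(1)] linear_map_comp[OF f e(4)]]) blast
    have pi0: "p (i x) = \<zero>\<^bsub>C\<^esub>" if "x \<in> carrier N" for x
    proof -
      have "i x \<in> a_kernel E C p" using e(7) that by blast
      then show ?thesis by (simp add: a_kernel_iff)
    qed
    have kills: "p (g x) = \<zero>\<^bsub>C\<^esub>" if x: "x \<in> carrier (res0 R N)" "res_eval R N x = \<zero>\<^bsub>N\<^esub>" for x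
    proof -
      have k: "x \<in> res_ker0 R N" using x by (simp add: res_ker0_iff)
      then have "f x \<in> carrier N" using linear_map_closed[OF f] by simp
      then show ?thesis using pi0 g(2)[OF k] by simp
    qed
    obtain d where d: "linear_map R N C d" "\<And>x. x \<in> carrier (res0 R N) \<Longrightarrow> d (res_eval R N x) = p (g x)"
      by (rule factor_through_surjection[OF m0 e(1,3) res_eval_linear[OF e(1)] res_eval_surj[OF e(1)]
          linear_map_comp[OF g(1) e(5)]]) (use kills in blast)+
    obtain d' where d': "linear_map R E C d'" "\<And>x. x \<in> carrier N \<Longrightarrow> d' (i x) = d x"
      using ext d(1) unfolding extends_along_def by blast
    obtain D where D: "linear_map R E E D" "\<And>x. x \<in> carrier E \<Longrightarrow> p (D x) = d' x"
      by (rule split_projective_lift[OF e(2,2,3) sp e(5,8) d'(1)]) blast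
    \<comment> \<open>Both \<open>g\<close> and \<open>?c\<close> lift the same map to \<open>C\<close>, so their difference lands in \<open>N\<close>;
        on the relations \<open>?c\<close> vanishes.\<close>
    let ?c = "\<lambda>x. D (i (res_eval R N x))"
    have c: "linear_map R (res0 R N) E ?c"
      by (rule linear_map_comp[OF linear_map_comp[OF res_eval_linear[OF e(1)] e(4)] D(1)])
    have diff: "linear_map R (res0 R N) E (\<lambda>x. g x \<ominus>\<^bsub>E\<^esub> ?c x)"
      by (rule linear_map_sub[OF m0 e(2) g(1) c])
    have "(\<lambda>x. g x \<ominus>\<^bsub>E\<^esub> ?c x) ` carrier (res0 R N) \<subseteq> i ` carrier N"
    proof
      fix y assume "y \<in> (\<lambda>x. g x \<ominus>\<^bsub>E\<^esub> ?c x) ` carrier (res0 R N)"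
      then obtain x where x: "x \<in> carrier (res0 R N)" "y = g x \<ominus>\<^bsub>E\<^esub> ?c x" by blast
      note evx = linear_map_closed[OF res_eval_linear[OF e(1)] x(1)]
      have "p (?c x) = p (g x)"
        using D(2)[OF linear_map_closed[OF e(4) evx]] d'(2)[OF evx] d(2)[OF x(1)] by simp
      then have "p y = \<zero>\<^bsub>C\<^esub>"
        unfolding x(2) linear_map_diff[OF e(2,3,5) linear_map_closed[OF g(1) x(1)] linear_map_closed[OF c x(1)]]
        using minus_eq_zero_iff[OF e(3)] linear_map_closed[OF e(5) linear_map_closed[OF g(1) x(1)]] by simp
      then show "y \<in> i ` carrier N"
        unfolding e(7) a_kernel_iff using linear_map_closed[OF diff x(1)] x(2) by simp
    qed
    then obtain h where h: "linear_map R (res0 R N) N h"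
      "\<And>x. x \<in> carrier (res0 R N) \<Longrightarrow> i (h x) = g x \<ominus>\<^bsub>E\<^esub> ?c x"
      by (rule factor_through_injection[OF m0 e(1,2,4,6) diff]) blast
    have "h k = f k" if k: "k \<in> res_ker0 R N" for k
    proof -
      have k': "k \<in> carrier (res0 R N)" "res_eval R N k = \<zero>\<^bsub>N\<^esub>" using k by (simp_all add: res_ker0_iff)
      have "?c k = \<zero>\<^bsub>E\<^esub>"
        unfolding k'(2) linear_map_zero[OF e(1,2,4)] by (rule linear_map_zero[OF e(2,2) D(1)])
      then have "i (h k) = i (f k)"
        using h(2)[OF k'(1)] linear_map_closed[OF g(1) k'(1)] g(2)[OF k] by (simp add: a_minus_def)
      then show ?thesis
        using inj_onD[OF e(6)] linear_map_closed[OF h(1) k'(1)] linear_map_closed[OF f, of k] k by simp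
    qed
    then show "\<exists>h. linear_map R (res0 R N) N h \<and> (\<forall>k\<in>carrier (relations R N). h k = f k)"
      using h(1) by auto
  qed
qed

lemma Ext1_vanishes_of_is_syzygy:
  fixes M :: "('a, 'm) module"
  assumes "is_syzygy R n N M" and van: "Ext1_vanishes R M M"
  obtains N' :: "('a, 'm) module" where "mod_iso R N N'" "Ext1_vanishes R N' N'"
proof -
  obtain N' :: "('a, 'm) module" where iso: "mod_iso R N N'"
    and it: "if n \<ge> 0 then (syzygy_step R ^^ nat n) N' M else (cosyzygy_step R ^^ nat (- n)) N' M"
    using assms(1) unfolding is_syzygy_def by blast
  have "(syzygy_step R)\<^sup>*\<^sup>* N' M \<Longrightarrow> Ext1_vanishes R N' N'"
    by (erule converse_rtranclp_induct) (rule van, rule Ext1_vanishes_of_syzygy)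
  moreover have "(cosyzygy_step R)\<^sup>*\<^sup>* N' M \<Longrightarrow> Ext1_vanishes R N' N'"
    by (erule converse_rtranclp_induct) (rule van, rule Ext1_vanishes_of_cosyzygy)
  moreover have "(syzygy_step R)\<^sup>*\<^sup>* N' M \<or> (cosyzygy_step R)\<^sup>*\<^sup>* N' M"
    using it relpowp_imp_rtranclp[of "nat n" "syzygy_step R" N' M]
      relpowp_imp_rtranclp[of "nat (- n)" "cosyzygy_step R" N' M] by argo
  ultimately show ?thesis using that[OF iso] by blast
qed

end

text \<open>
  Minimality enters here: the kernel of a projective cover of \<open>0\<close> is the whole cover \<open>P\<close>, so the submodule \<open>0\<close>
  together with this kernel spans \<open>P\<close>, which forces \<open>P = 0\<close>. Dually for the injective hull below.
\<close>

lemma syzygy_step_zero: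
  fixes N K :: "('r, 'm) module"
  assumes "syzygy_step R N K" "zero_mod N"
  shows "zero_mod K"
proof -
  obtain P :: "('r, 'm) module" and p i where P: "projective_cover R P p N" and ex: "short_exact R K i P p N"
    using assms(1) unfolding syzygy_step_def by blast
  note e = short_exactD[OF ex]
  interpret P: module R P by (rule e(2))
  interpret K: module R K by (rule e(1))
  have ker: "a_kernel P N p = carrier P"
    using linear_map_closed[OF e(5)] assms(2) unfolding zero_mod_def a_kernel_def' by auto
  have "submodule {\<zero>\<^bsub>P\<^esub>} R P" by (rule P.submoduleI) auto
  moreover have "{\<zero>\<^bsub>P\<^esub>} <+>\<^bsub>P\<^esub> a_kernel P N p = carrier P"
    unfolding ker set_add_def' by auto
  ultimately have "{\<zero>\<^bsub>P\<^esub>} = carrier P" using P unfolding projective_cover_def by blast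
  then have i0: "i x = \<zero>\<^bsub>P\<^esub>" if "x \<in> carrier K" for x
    using linear_map_closed[OF e(4) that] by blast
  have "x = \<zero>\<^bsub>K\<^esub>" if "x \<in> carrier K" for x
    by (rule inj_onD[OF e(6) _ that K.zero_closed]) (simp add: i0 that)
  then show ?thesis unfolding zero_mod_def using K.zero_closed by blast
qed

lemma cosyzygy_step_zero:
  fixes N C :: "('r, 'm) module"
  assumes "cosyzygy_step R N C" "zero_mod N"
  shows "zero_mod C"
proof -
  obtain E :: "('r, 'm) module" and i p where E: "injective_hull R N i E" and ex: "short_exact R N i E p C"
    using assms(1) unfolding cosyzygy_step_def by blast
  note e = short_exactD[OF ex]
  interpret E: module R E by (rule e(2))
  have im: "i ` carrier N = {\<zero>\<^bsub>E\<^esub>}"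
    using linear_map_zero[OF e(1,2,4)] assms(2) unfolding zero_mod_def by simp
  have "carrier E \<inter> i ` carrier N = {\<zero>\<^bsub>E\<^esub>}" unfolding im by auto
  then have "carrier E = {\<zero>\<^bsub>E\<^esub>}"
    using E E.carrier_is_submodule unfolding injective_hull_def by blast
  then show ?thesis using linear_map_zero[OF e(2,3,5)] unfolding zero_mod_def e(8)[symmetric] by simp
qed

lemma is_syzygy_zero:
  fixes M :: "('r, 'm) module"
  assumes "is_syzygy R n N M" "zero_mod N"
  shows "zero_mod M"
proof -
  obtain N' :: "('r, 'm) module" where iso: "mod_iso R N N'"
    and it: "if n \<ge> 0 then (syzygy_step R ^^ nat n) N' M else (cosyzygy_step R ^^ nat (- n)) N' M"
    using assms(1) unfolding is_syzygy_def by blast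
  obtain f where f: "linear_map R N N' f" "bij_betw f (carrier N) (carrier N')"
    using iso linear_map_mod_Hom unfolding mod_iso_def by blast
  have mods: "module R N" "module R N'" using iso unfolding mod_iso_def by blast+
  have z: "zero_mod N'"
    using assms(2) linear_map_zero[OF mods f(1)]
    unfolding zero_mod_def bij_betw_imp_surj_on[OF f(2), symmetric] by simp
  have "(syzygy_step R)\<^sup>*\<^sup>* N' M \<Longrightarrow> zero_mod M"
    by (erule rtranclp_induct) (rule z, rule syzygy_step_zero)
  moreover have "(cosyzygy_step R)\<^sup>*\<^sup>* N' M \<Longrightarrow> zero_mod M"
    by (erule rtranclp_induct) (rule z, rule cosyzygy_step_zero)
  moreover have "(syzygy_step R)\<^sup>*\<^sup>* N' M \<or> (cosyzygy_step R)\<^sup>*\<^sup>* N' M"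
    using it relpowp_imp_rtranclp[of "nat n" "syzygy_step R" N' M]
      relpowp_imp_rtranclp[of "nat (- n)" "cosyzygy_step R" N' M] by argo
  ultimately show ?thesis by blast
qed

section \<open>Trace modules are not rigid\<close>

context local_self_injective
begin

text \<open>
  The map \<open>j\<close> is the inclusion of the trace submodule, up to an isomorphism. The map \<open>N \<rightarrow> k \<rightarrow> Y/N\<close> is built with the socle \<open>R \<sigma>\<close> of \<open>R\<close> as a
  model of the residue field \<open>k\<close>: a nonzero map \<open>\<theta> : N \<rightarrow> R\<close> with \<open>m \<theta> = 0\<close> has values \<open>\<theta> n = r n \<sigma>\<close>, where
  \<open>r n\<close> is unique modulo \<open>m\<close>. With \<open>y\<close> representing a socle element of \<open>Y/N\<close>, the map is \<open>n \<mapsto> r n y\<close>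
  modulo \<open>N\<close>. If \<open>Ext\<^sup>1(N, N)\<close> vanished, it would lift to a map \<open>N \<rightarrow> Y\<close>; but such a map takes values in
  \<open>N\<close>, so \<open>n \<mapsto> r n y\<close> would be zero modulo \<open>N\<close>.
\<close>

lemma trace_submodule_not_Ext1_vanishes:
  fixes N :: "('a, 'n) module" and Y :: "('a, 'y) module"
  assumes mN: "module R N" and mY: "module R Y"
    and j: "linear_map R N Y j" "inj_on j (carrier N)"
    and trace: "\<And>\<phi>. linear_map R N Y \<phi> \<Longrightarrow> \<phi> ` carrier N \<subseteq> j ` carrier N"
    and nz: "\<not> zero_mod N" and proper: "j ` carrier N \<noteq> carrier Y"
  shows "\<not> Ext1_vanishes R N N"
proof
  assume van: "Ext1_vanishes R N N"
  interpret N: module R N by (rule mN)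
  interpret Y: module R Y by (rule mY)
  let ?S = "self_module R"
  have mS: "module R ?S" by (rule self_module_module)
  interpret S: module R ?S by (rule mS)
  obtain \<sigma> where \<sigma>: "\<sigma> \<in> carrier R" "\<sigma> \<noteq> \<zero>" "\<And>r. r \<in> m \<Longrightarrow> r \<otimes> \<sigma> = \<zero>"
    "\<And>r. r \<in> carrier R \<Longrightarrow> r \<noteq> \<zero> \<Longrightarrow> \<exists>t\<in>carrier R. t \<otimes> r = \<sigma>"
    using socle_generator by blast
  have \<sigma>S: "\<sigma> \<in> carrier ?S" using \<sigma>(1) by simp
  obtain x0 where x0: "x0 \<in> carrier N" "x0 \<noteq> \<zero>\<^bsub>N\<^esub>" using nz N.zero_closed unfolding zero_mod_def by blast
  have "r \<odot>\<^bsub>?S\<^esub> \<sigma> = \<zero>\<^bsub>?S\<^esub>" if "r \<in> carrier R" "r \<odot>\<^bsub>N\<^esub> x0 = \<zero>\<^bsub>N\<^esub>" for r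
    using annihilator_subset_m[OF mN x0 that] \<sigma>(3) by simp
  then obtain \<theta>0 where \<theta>0: "linear_map R N ?S \<theta>0" "\<theta>0 x0 = \<sigma>"
    by (rule baer_extend_cyclic[OF mS mN self_injective x0(1) \<sigma>S])
  have \<theta>0c: "\<theta>0 n \<in> carrier R" if "n \<in> carrier N" for n using linear_map_closed[OF \<theta>0(1) that] by simp
  \<comment> \<open>A socle element of \<open>R\<close> modulo the annihilator of \<open>\<theta>0\<close> turns \<open>\<theta>0\<close> into a nonzero map
      with values in the socle.\<close>
  let ?T = "{a \<in> carrier R. \<forall>n\<in>carrier N. a \<otimes> \<theta>0 n = \<zero>}"
  have T: "submodule ?T R ?S"
  proof (rule S.submoduleI)
    show sm: "a \<odot>\<^bsub>?S\<^esub> b \<in> ?T" if "a \<in> carrier R" "b \<in> ?T" for a b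
      using that \<theta>0c by (simp add: m_assoc)
    show "\<ominus>\<^bsub>?S\<^esub> a \<in> ?T" if "a \<in> ?T" for a
      using sm[of "\<ominus> \<one>" a] S.smult_l_minus[of \<one> a] S.a_inv_closed[of a] that by simp
  qed (use \<theta>0c in \<open>auto simp: l_distr\<close>)
  have "\<one> \<notin> ?T" using x0(1) \<theta>0(2) \<sigma>(1,2) by (auto intro!: bexI[of _ x0])
  then have T': "?T \<noteq> carrier ?S" using one_closed unfolding self_module_simps by blast
  obtain a where a: "a \<in> carrier R" "a \<notin> ?T" "\<And>r. r \<in> m \<Longrightarrow> r \<otimes> a \<in> ?T"
  proof (rule socle_element[OF mS T T'])
    fix a assume a: "a \<in> carrier ?S" "a \<notin> ?T" "\<And>s. s \<in> m \<Longrightarrow> s \<odot>\<^bsub>?S\<^esub> a \<in> ?T"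
    show thesis by (rule that[of a]) (use a in simp_all)
  qed
  define \<theta> where "\<theta> n = a \<otimes> \<theta>0 n" for n
  have \<theta>: "linear_map R N ?S \<theta>"
    unfolding \<theta>_def
    by (rule linear_mapI) (use a(1) \<theta>0c linear_map_add[OF \<theta>0(1)] linear_map_smult[OF \<theta>0(1)] in
        \<open>simp_all add: r_distr m_lcomm\<close>)
  have \<theta>c: "\<theta> n \<in> carrier R" if "n \<in> carrier N" for n using linear_map_closed[OF \<theta> that] by simp
  have m\<theta>: "r \<otimes> \<theta> n = \<zero>" if "r \<in> m" "n \<in> carrier N" for r n
    using a(1) a(3)[OF that(1)] that \<theta>0c m_subset unfolding \<theta>_def by (auto simp: m_assoc)
  obtain n1 where n1: "n1 \<in> carrier N" "\<theta> n1 \<noteq> \<zero>" using a(1,2) unfolding \<theta>_def by blast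
  have "\<exists>r\<in>carrier R. r \<otimes> \<sigma> = \<theta> n" if n: "n \<in> carrier N" for n
  proof (cases "\<theta> n = \<zero>")
    case True
    then show ?thesis using \<sigma>(1) by (intro bexI[of _ \<zero>]) simp_all
  next
    case False
    then obtain t where t: "t \<in> carrier R" "t \<otimes> \<theta> n = \<sigma>" using \<sigma>(4) \<theta>c[OF n] by blast
    then have "t \<notin> m" using m\<theta> n \<sigma>(2) by auto
    then obtain s where s: "s \<in> carrier R" "s \<otimes> t = \<one>" using invertible t(1) by blast
    have "s \<otimes> \<sigma> = \<theta> n" using s t \<theta>c[OF n] by (metis l_one m_assoc)
    then show ?thesis using s(1) by blast
  qed
  then obtain r where r: "\<And>n. n \<in> carrier N \<Longrightarrow> r n \<in> carrier R" "\<And>n. n \<in> carrier N \<Longrightarrow> r n \<otimes> \<sigma> = \<theta> n"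
    by metis
  have J: "submodule (j ` carrier N) R Y" by (rule image_submodule[OF mN mY j(1)])
  note Js = Y.submoduleE[OF J]
  obtain y where y: "y \<in> carrier Y" "y \<notin> j ` carrier N" "\<And>s. s \<in> m \<Longrightarrow> s \<odot>\<^bsub>Y\<^esub> y \<in> j ` carrier N"
    using socle_element[OF mY J proper] by blast
  \<comment> \<open>On the free module, \<open>?\<rho>\<close> lifts \<open>\<theta>\<close> along \<open>R \<rightarrow> R \<sigma>\<close>, and \<open>?l\<close> lifts the map to \<open>Y/N\<close>.\<close>
  let ?F = "free_mod R (carrier N)"
  let ?\<rho> = "free_lift R ?S r" and ?l = "free_lift R Y (\<lambda>n. r n \<odot>\<^bsub>Y\<^esub> y)"
  have rS: "r \<in> carrier N \<rightarrow> carrier ?S" using r(1) by auto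
  have \<rho>: "linear_map R ?F ?S ?\<rho>" by (rule free_lift_linear[OF mS rS])
  have ry: "(\<lambda>n. r n \<odot>\<^bsub>Y\<^esub> y) \<in> carrier N \<rightarrow> carrier Y" using r(1) y(1) by auto
  have l: "linear_map R (res0 R N) Y ?l"
    unfolding res0_def by (rule free_lift_linear[OF mY ry])
  have l\<rho>: "?l x = ?\<rho> x \<odot>\<^bsub>Y\<^esub> y" if "x \<in> carrier ?F" for x
    using free_lift_comp[OF mS mY linear_map_cyclic[OF mY y(1)] rS that] by simp
  have \<theta>\<rho>: "\<theta> (res_eval R N x) = ?\<rho> x \<otimes> \<sigma>" if x: "x \<in> carrier ?F" for x
  proof -
    have "\<theta> (res_eval R N x) = free_lift R ?S (\<lambda>n. \<theta> n) x"
      by (rule free_lift_comp[OF mN mS \<theta> _ x]) simp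
    also have "\<dots> = free_lift R ?S (\<lambda>n. r n \<odot>\<^bsub>?S\<^esub> \<sigma>) x"
      by (rule free_lift_cong[OF mS x]) (use r \<sigma>(1) in auto)
    also have "\<dots> = ?\<rho> x \<odot>\<^bsub>?S\<^esub> \<sigma>"
      by (rule free_lift_comp[OF mS mS linear_map_cyclic[OF mS \<sigma>S] rS x, symmetric])
    finally show ?thesis by simp
  qed
  have lk: "?l k \<in> j ` carrier N" if "k \<in> res_ker0 R N" for k
  proof -
    have k: "k \<in> carrier ?F" "res_eval R N k = \<zero>\<^bsub>N\<^esub>" using that by (simp_all add: res_ker0_iff res0_def)
    have \<rho>k: "?\<rho> k \<in> carrier R" using linear_map_closed[OF \<rho> k(1)] by simp
    have "?\<rho> k \<otimes> \<sigma> = \<zero>" using \<theta>\<rho>[OF k(1)] k(2) linear_map_zero[OF mN mS \<theta>] by simp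
    then have "?\<rho> k \<in> m" using annihilator_subset_m[OF mS \<sigma>S _ \<rho>k] \<sigma>(2) by simp
    then show ?thesis using y(3) l\<rho>[OF k(1)] by simp
  qed
  obtain d where d: "linear_map R N Y d"
    "\<And>x. x \<in> carrier (res0 R N) \<Longrightarrow> ?l x \<ominus>\<^bsub>Y\<^esub> d (res_eval R N x) \<in> j ` carrier N"
    by (rule Ext1_vanishes_lift_modulo[OF mN mN mY j l _ van]) (use lk in blast)+
  have e: "unit_vector R n1 \<in> carrier ?F" by (rule unit_vector_closed[OF n1(1)])
  have le: "?l (unit_vector R n1) = r n1 \<odot>\<^bsub>Y\<^esub> y" by (rule free_lift_unit_vector[OF mY n1(1) ry])
  have ee: "res_eval R N (unit_vector R n1) = n1" by (rule free_lift_unit_vector[OF mN n1(1)]) simp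
  have dn: "d n1 \<in> j ` carrier N" using trace[OF d(1)] n1(1) by blast
  have "r n1 \<odot>\<^bsub>Y\<^esub> y \<ominus>\<^bsub>Y\<^esub> d n1 \<in> j ` carrier N"
    using d(2)[of "unit_vector R n1"] e unfolding le ee by (simp add: res0_def)
  then have "(r n1 \<odot>\<^bsub>Y\<^esub> y \<ominus>\<^bsub>Y\<^esub> d n1) \<oplus>\<^bsub>Y\<^esub> d n1 \<in> j ` carrier N" using dn by (rule Js(5))
  moreover have "(r n1 \<odot>\<^bsub>Y\<^esub> y \<ominus>\<^bsub>Y\<^esub> d n1) \<oplus>\<^bsub>Y\<^esub> d n1 = r n1 \<odot>\<^bsub>Y\<^esub> y"
    using r(1)[OF n1(1)] y(1) linear_map_closed[OF d(1) n1(1)]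
    by (simp add: a_minus_def Y.a_assoc Y.l_neg)
  ultimately have ryj: "r n1 \<odot>\<^bsub>Y\<^esub> y \<in> j ` carrier N" by simp
  have "r n1 \<notin> m" using r(2)[OF n1(1)] \<sigma>(3) n1(2) by auto
  then obtain s where s: "s \<in> carrier R" "s \<otimes> r n1 = \<one>" using invertible r(1)[OF n1(1)] by blast
  have "s \<odot>\<^bsub>Y\<^esub> (r n1 \<odot>\<^bsub>Y\<^esub> y) = y"
    using s r(1)[OF n1(1)] y(1) by (metis Y.smult_assoc1 Y.smult_one)
  then have "y \<in> j ` carrier N" using Js(4)[OF s(1) ryj] by simp
  then show False using y(2) by blast
qed

end

text \<open>
  An element of \<open>T\<close> is a finite sum of values \<open>\<alpha> a\<close>, and \<open>\<phi> \<circ> \<alpha>\<close> is again a homomorphism from \<open>A\<close> to \<open>Y\<close>. The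
  sum is treated by induction on the index set rather than by reindexing, since \<open>\<alpha> \<mapsto> \<phi> \<circ> \<alpha>\<close> may fail to be injective.
\<close>

lemma trace_module_invariant:
  fixes R :: "('r, 's) ring_scheme" and A :: "('r, 'a) module" and Y :: "('r, 'x) module"
  defines "T \<equiv> trace_module R A Y"
  assumes mA: "module R A" and mY: "module R Y" and mT: "module R (Y\<lparr>carrier := T\<rparr>)"
    and \<phi>: "linear_map R (Y\<lparr>carrier := T\<rparr>) Y \<phi>" and t: "t \<in> T"
  shows "\<phi> t \<in> T"
proof -
  interpret A: module R A by (rule mA)
  interpret Y: module R Y by (rule mY)
  interpret T: module R "Y\<lparr>carrier := T\<rparr>" by (rule mT)
  let ?N = "Y\<lparr>carrier := T\<rparr>"
  have zero: "\<zero>\<^bsub>Y\<^esub> \<in> T" using T.zero_closed by simp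
  have add: "x \<oplus>\<^bsub>Y\<^esub> y \<in> T" if "x \<in> T" "y \<in> T" for x y using T.a_closed that by simp
  have \<phi>0: "\<phi> \<zero>\<^bsub>Y\<^esub> = \<zero>\<^bsub>Y\<^esub>" using linear_map_zero[OF mT mY \<phi>] by simp
  have image: "\<alpha> a \<in> T" if \<alpha>: "\<alpha> \<in> mod_Hom R A Y" and a: "a \<in> carrier A" for \<alpha> a
  proof -
    have cl: "\<alpha> a \<in> carrier Y" using linear_map_closed[OF linear_map_mod_Hom[OF \<alpha>] a] .
    have "(\<Oplus>\<^bsub>Y\<^esub>\<beta>\<in>{\<alpha>}. \<beta> ((\<lambda>_. a) \<beta>)) = \<alpha> a \<oplus>\<^bsub>Y\<^esub> (\<Oplus>\<^bsub>Y\<^esub>\<beta>\<in>{}. \<beta> ((\<lambda>_. a) \<beta>))"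
      by (rule Y.finsum_insert) (use cl in simp_all)
    also have "\<dots> = \<alpha> a" using cl by (simp only: Y.finsum_empty Y.r_zero)
    finally have sum: "\<alpha> a = (\<Oplus>\<^bsub>Y\<^esub>\<beta>\<in>{\<alpha>}. \<beta> ((\<lambda>_. a) \<beta>))" by (rule sym)
    show ?thesis
      unfolding T_def trace_module_def mem_Collect_eq
      by (rule exI[of _ "{\<alpha>}"], rule exI[of _ "\<lambda>_. a"], intro conjI, rule sum) (use \<alpha> a in simp_all)
  qed
  have \<phi>image: "\<phi> (\<alpha> a) \<in> T" if \<alpha>: "\<alpha> \<in> mod_Hom R A Y" and a: "a \<in> carrier A" for \<alpha> a
  proof -
    have "linear_map R A ?N \<alpha>"
      by (rule linear_map_codomain[OF linear_map_mod_Hom[OF \<alpha>]]) (use image[OF \<alpha>] in blast)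
    then have "linear_map R A Y (\<lambda>x. \<phi> (\<alpha> x))" using \<phi> by (rule linear_map_comp)
    then have "restrict (\<lambda>x. \<phi> (\<alpha> x)) (carrier A) \<in> mod_Hom R A Y" by (rule restrict_mod_Hom[OF _ mA])
    from image[OF this a] show ?thesis using a by simp
  qed
  obtain S u where S: "finite S" "S \<subseteq> mod_Hom R A Y" "u \<in> S \<rightarrow> carrier A"
    and tS: "t = (\<Oplus>\<^bsub>Y\<^esub>\<alpha>\<in>S. \<alpha> (u \<alpha>))"
    using t unfolding T_def trace_module_def by blast
  have "(\<Oplus>\<^bsub>Y\<^esub>\<alpha>\<in>S. \<alpha> (u \<alpha>)) \<in> T \<and> \<phi> (\<Oplus>\<^bsub>Y\<^esub>\<alpha>\<in>S. \<alpha> (u \<alpha>)) \<in> T"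
    using S
  proof (induction S)
    case empty
    then show ?case using zero \<phi>0 by simp
  next
    case (insert \<alpha> S)
    have IH: "(\<Oplus>\<^bsub>Y\<^esub>\<alpha>\<in>S. \<alpha> (u \<alpha>)) \<in> T" "\<phi> (\<Oplus>\<^bsub>Y\<^esub>\<alpha>\<in>S. \<alpha> (u \<alpha>)) \<in> T" using insert by auto
    have \<alpha>: "\<alpha> \<in> mod_Hom R A Y" "u \<alpha> \<in> carrier A" using insert.prems by auto
    have cl: "\<beta> (u \<beta>) \<in> carrier Y" if "\<beta> \<in> insert \<alpha> S" for \<beta>
    proof -
      have "\<beta> \<in> mod_Hom R A Y" "u \<beta> \<in> carrier A" using insert.prems that by auto
      then show ?thesis by (rule linear_map_closed[OF linear_map_mod_Hom])
    qed
    have "(\<Oplus>\<^bsub>Y\<^esub>\<alpha>\<in>insert \<alpha> S. \<alpha> (u \<alpha>)) = \<alpha> (u \<alpha>) \<oplus>\<^bsub>Y\<^esub> (\<Oplus>\<^bsub>Y\<^esub>\<alpha>\<in>S. \<alpha> (u \<alpha>))"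
      by (rule Y.finsum_insert) (use insert.hyps cl in auto)
    moreover have "\<phi> (\<alpha> (u \<alpha>) \<oplus>\<^bsub>Y\<^esub> (\<Oplus>\<^bsub>Y\<^esub>\<alpha>\<in>S. \<alpha> (u \<alpha>))) = \<phi> (\<alpha> (u \<alpha>)) \<oplus>\<^bsub>Y\<^esub> \<phi> (\<Oplus>\<^bsub>Y\<^esub>\<alpha>\<in>S. \<alpha> (u \<alpha>))"
      using linear_map_add[OF \<phi>] image[OF \<alpha>] IH(1) by simp
    ultimately show ?case using add image[OF \<alpha>] \<phi>image[OF \<alpha>] IH by simp
  qed
  then show ?thesis unfolding tS by blast
qed

context local_self_injective
begin

text \<open>
  The iteration of syzygies starts from an isomorphic copy of the submodule \<open>T\<close>, so the inclusion of \<open>T\<close> is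
  replaced by the inverse \<open>j\<close> of the isomorphism.
\<close>

lemma syzygy_not_Ext1_vanishes:
  fixes Y :: "('a, 'y) module" and M :: "('a, 'm) module"
  defines "N T \<equiv> Y\<lparr>carrier := T\<rparr>"
  assumes mY: "module R Y" and T: "T \<subset> carrier Y" and nz: "T \<noteq> {\<zero>\<^bsub>Y\<^esub>}"
    and trace: "\<And>\<phi> t. linear_map R (N T) Y \<phi> \<Longrightarrow> t \<in> T \<Longrightarrow> \<phi> t \<in> T"
    and syz: "is_syzygy R n (N T) M"
  shows "\<not> Ext1_vanishes R M M"
proof
  assume "Ext1_vanishes R M M"
  then obtain N' :: "('a, 'm) module" where iso: "mod_iso R (N T) N'" and van: "Ext1_vanishes R N' N'"
    by (rule Ext1_vanishes_of_is_syzygy[OF syz])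
  obtain f where f: "linear_map R (N T) N' f" "bij_betw f (carrier (N T)) (carrier N')"
    using iso linear_map_mod_Hom unfolding mod_iso_def by blast
  have mN: "module R (N T)" "module R N'" using iso unfolding mod_iso_def by blast+
  have surj: "f ` T = carrier N'" using bij_betw_imp_surj_on[OF f(2)] by (simp add: N_def)
  have inj: "inj_on f T" using bij_betw_imp_inj_on[OF f(2)] by (simp add: N_def)
  obtain j where j: "linear_map R N' (N T) j" "\<And>x. x \<in> carrier N' \<Longrightarrow> f (j x) = x"
    by (rule factor_through_injection[OF mN(2,1,2) f(1) bij_betw_imp_inj_on[OF f(2)] linear_map_id])
      (use surj in \<open>auto simp: N_def\<close>)
  have jT: "j x \<in> T" if "x \<in> carrier N'" for x using linear_map_closed[OF j(1) that] by (simp add: N_def)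
  have jf: "j (f t) = t" if t: "t \<in> T" for t
  proof (rule inj_onD[OF inj _ _ t])
    have ft: "f t \<in> carrier N'" using surj t by blast
    show "f (j (f t)) = f t" by (rule j(2)[OF ft])
    show "j (f t) \<in> T" by (rule jT[OF ft])
  qed
  have jim: "j ` carrier N' = T"
  proof
    show "j ` carrier N' \<subseteq> T" using jT by blast
    show "T \<subseteq> j ` carrier N'"
    proof
      fix t assume t: "t \<in> T"
      then have "f t \<in> carrier N'" using surj by blast
      then have "j (f t) \<in> j ` carrier N'" by (rule imageI)
      then show "t \<in> j ` carrier N'" unfolding jf[OF t] .
    qed
  qed
  have jY: "linear_map R N' Y j"
    using j(1) T unfolding N_def by (rule linear_map_codomain_superset[OF _ psubset_imp_subset])
  have "inj_on j (carrier N')" by (rule inj_on_inverseI[of _ f]) (rule j(2))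
  moreover have "\<phi> ` carrier N' \<subseteq> j ` carrier N'" if \<phi>: "linear_map R N' Y \<phi>" for \<phi>
  proof
    fix y assume "y \<in> \<phi> ` carrier N'"
    then obtain t where t: "t \<in> T" "y = \<phi> (f t)" unfolding surj[symmetric] by auto
    have "\<phi> (f t) \<in> T" by (rule trace[OF linear_map_comp[OF f(1) \<phi>] t(1)])
    then show "y \<in> j ` carrier N'" unfolding jim t(2) .
  qed
  moreover have "\<not> zero_mod N'"
  proof
    assume "zero_mod N'"
    then have "T = {j \<zero>\<^bsub>N'\<^esub>}" using jim unfolding zero_mod_def by simp
    also have "j \<zero>\<^bsub>N'\<^esub> = \<zero>\<^bsub>Y\<^esub>" by (rule linear_map_zero[OF mN(2) mY jY])
    finally show False using nz by blast
  qed
  moreover have "j ` carrier N' \<noteq> carrier Y" using jim T by blast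
  ultimately show False using trace_submodule_not_Ext1_vanishes[OF mN(2) mY jY] van by blast
qed

lemma ideal_invariant:
  assumes I: "ideal I R" and \<phi>: "linear_map R ((self_module R)\<lparr>carrier := I\<rparr>) (self_module R) \<phi>" and t: "t \<in> I"
  shows "\<phi> t \<in> I"
proof -
  have "\<exists>w\<in>carrier (self_module R). \<forall>r\<in>I. \<phi> r = r \<odot>\<^bsub>self_module R\<^esub> w"
    using self_injective I \<phi> unfolding baer_def by blast
  then obtain w where w: "w \<in> carrier R" "\<And>r. r \<in> I \<Longrightarrow> \<phi> r = r \<otimes> w" by auto
  then show ?thesis using ideal.I_r_closed[OF I t w(1)] t by simp
qed

end

theorem theorem3p9:
  fixes R :: "('r, 's) ring_scheme"
  assumes "local_ring R" and "artinian_gorenstein_ring R"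
  shows "(\<forall>(A :: ('r, 'a) module) (Y :: ('r, 'x) module) (n :: int) (M :: ('r, 'm) module).
            module R A \<and> module R Y \<and> module R M \<and>
            trace_module R A Y \<subset> carrier Y \<and>
            is_syzygy R n (Y\<lparr>carrier := trace_module R A Y\<rparr>) M \<and>
            \<not> zero_mod M \<longrightarrow>
            carrier (Ext1 R M M) \<noteq> {\<one>\<^bsub>Ext1 R M M\<^esub>}) \<and>
         (\<forall>I (n :: int) (M :: ('r, 'm) module).
            ideal I R \<and> I \<noteq> {\<zero>\<^bsub>R\<^esub>} \<and> I \<noteq> carrier R \<and>
            module R M \<and>
            is_syzygy R n ((self_module R)\<lparr>carrier := I\<rparr>) M \<longrightarrow>
            \<not> rigid R M)"
proof (intro conjI allI impI)
  have R: "cring R" "noetherian_ring R" "artinian_ring R" "injective_mod R (self_module R)"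
    using assms(2) unfolding artinian_gorenstein_ring_def by blast+
  obtain m where "local_artinian R m" by (rule local_artinianI[OF assms(1) R(2,3)])
  then interpret local_self_injective R m
    by (intro local_self_injective.intro local_self_injective_axioms.intro injective_mod_baer[OF R(1,4)])
  {
    fix A :: "('r, 'a) module" and Y :: "('r, 'x) module" and n :: int and M :: "('r, 'm) module"
    let ?T = "trace_module R A Y"
    assume "module R A \<and> module R Y \<and> module R M \<and> ?T \<subset> carrier Y \<and>
      is_syzygy R n (Y\<lparr>carrier := ?T\<rparr>) M \<and> \<not> zero_mod M"
    then have h: "module R A" "module R Y" "module R M" "?T \<subset> carrier Y"
      "is_syzygy R n (Y\<lparr>carrier := ?T\<rparr>) M" "\<not> zero_mod M" by blast+
    have mT: "module R (Y\<lparr>carrier := ?T\<rparr>)" using h(5) unfolding is_syzygy_def mod_iso_def by blast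
    have nz: "?T \<noteq> {\<zero>\<^bsub>Y\<^esub>}" using is_syzygy_zero[OF h(5)] h(6) by (auto simp: zero_mod_def)
    have "\<not> Ext1_vanishes R M M"
      by (rule syzygy_not_Ext1_vanishes[OF h(2,4) nz _ h(5)]) (rule trace_module_invariant[OF h(1,2) mT])
    then show "carrier (Ext1 R M M) \<noteq> {\<one>\<^bsub>Ext1 R M M\<^esub>}"
      using Ext1_trivial_imp_vanishes[OF h(3,3)] by blast
  }
  {
    fix I and n :: int and M :: "('r, 'm) module"
    assume "ideal I R \<and> I \<noteq> {\<zero>\<^bsub>R\<^esub>} \<and> I \<noteq> carrier R \<and> module R M \<and>
      is_syzygy R n ((self_module R)\<lparr>carrier := I\<rparr>) M"
    then have h: "ideal I R" "I \<noteq> {\<zero>\<^bsub>R\<^esub>}" "I \<noteq> carrier R" "module R M"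
      "is_syzygy R n ((self_module R)\<lparr>carrier := I\<rparr>) M" by blast+
    have I: "I \<subset> carrier (self_module R)" using ideal.Icarr[OF h(1)] h(3) by auto
    have nz: "I \<noteq> {\<zero>\<^bsub>self_module R\<^esub>}" using h(2) by simp
    have "\<not> Ext1_vanishes R M M"
      by (rule syzygy_not_Ext1_vanishes[OF self_module_module I nz _ h(5)]) (rule ideal_invariant[OF h(1)])
    then show "\<not> rigid R M"
      using Ext1_trivial_imp_vanishes[OF h(4,4)] unfolding rigid_def by blast
  }
qed

end
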